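(* If $n\ge 3$, the family $(K(\underline{P}))_{\underline{P}\in\mathbb{Z}^{3n-1}}$ admits a Rhin-Viola group of order $32$, isomorphic to $(V\times V)\rtimes\mathbb{Z}/2\mathbb{Z}$, where $V=\mathbb{Z}/2\mathbb{Z}\times\mathbb{Z}/2\mathbb{Z}$ is the Klein group and $\mathbb{Z}/2\mathbb{Z}$ acts by permuting the factors of $V\times V$. This comes from analogues of the transformations denoted $\sigma$ and $\chi$ by Rhin and Viola (in "The group structure for $\zeta(3)$", Acta Arith. 97.3 (2001), 269-293), and from the change of variables defined by $$y'_k=\frac{1-y_1\cdots y_{n-k+1}}{1-y_1\cdots y_{n-k+2}}\quad\text{for all } k\in\{1,\ldots,n\},$$ with the convention $y_{n+1}=0$.
   Context: For $\underline{P}=(A_1,\ldots,A_n,B_1,\ldots,B_n,C_2,\ldots,C_n)\in\mathbb{Z}^{3n-1}$, the (possibly infinite) integral $K(\underline{P})$ is $$K(\underline{P})=\int_{[0,1]^n}\frac{\prod_{k=1}^n y_k^{A_k}(1-y_k)^{B_k}}{\prod_{k=2}^n(1-y_1y_2\cdots y_k)^{C_k+1}}\,dy_1\cdots dy_n.$$ Definition: a family of numbers $I(\underline{p})\in\mathbb{R}_+^*\cup\{\infty\}$, parametrized by $\underline{p}\in\mathbb{Z}^s$, is said to admit a subgroup $G$ of $\mathrm{GL}_s(\mathbb{Z})$ as a Rhin-Viola group if $I(g\underline{p})/I(\underline{p})$ is a nonzero rational number for all $g\in G$ and all $\underline{p}\in\mathbb{Z}^s$ (with the convention $\infty/\inf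ty=1$).
   Formalization: The ratio I(gp)/I(p) is required to be a nonzero rational only when I(gp) and I(p) are both finite or both infinite; pairs with exactly one infinite value are excluded, since χ sends some convergent integrals (C_n=-1, other entries 0) to divergent ones. *)

theory Defs
  imports
    "HOL-Analysis.Analysis"
    "HOL-Algebra.Elementary_Groups"
    "HOL-Combinatorics.Transposition"
    "Jordan_Normal_Form.Matrix"
begin

section \<open>Rhin-Viola groups\<close>

definition GL :: "nat \<Rightarrow> int mat monoid" where
  "GL s = units_of (ring_mat TYPE(int) s ())"

definition rv_quotient :: "ennreal \<Rightarrow> ennreal \<Rightarrow> ennreal" where
  "rv_quotient x y = (if x = \<infinity> \<and> y = \<infinity> then 1 else x / y)"

text \<open>
  The quotient \<open>I (g p) / I p\<close> is a number when both values are finite, and the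
  convention \<open>\<infinity> / \<infinity> = 1\<close> covers the case of two infinite values. When exactly one of
  them is infinite there is no quotient, and nothing is required: hypergeometric
  transformations do send some convergent integrals to divergent ones.
\<close>

definition rhin_viola_group :: "nat \<Rightarrow> (int vec \<Rightarrow> ennreal) \<Rightarrow> int mat set \<Rightarrow> bool" where
  "rhin_viola_group s I G \<longleftrightarrow>
     (\<forall>p\<in>carrier_vec s. 0 < I p) \<and>
     subgroup G (GL s) \<and>
     (\<forall>g\<in>G. \<forall>p\<in>carrier_vec s. (I (g *\<^sub>v p) = \<infinity> \<longleftrightarrow> I p = \<infinity>) \<longrightarrow>
        (\<exists>q::rat. 0 < q \<and> rv_quotient (I (g *\<^sub>v p)) (I p) = ennreal (of_rat q)))"


section \<open>The integrals\<close>

text \<open>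
  A parameter is a vector \<open>(A\<^sub>1, \<dots>, A\<^sub>n, B\<^sub>1, \<dots>, B\<^sub>n, C\<^sub>2, \<dots>, C\<^sub>n)\<close> of dimension \<open>3 n - 1\<close>,
  with entries numbered from \<open>0\<close>.
\<close>

definition parA :: "nat \<Rightarrow> int vec \<Rightarrow> nat \<Rightarrow> int" where
  "parA n P k = vec_index P (k - 1)"

definition parB :: "nat \<Rightarrow> int vec \<Rightarrow> nat \<Rightarrow> int" where
  "parB n P k = vec_index P (n + k - 1)"

definition parC :: "nat \<Rightarrow> int vec \<Rightarrow> nat \<Rightarrow> int" where
  "parC n P k = vec_index P (2 * n + k - 2)"

definition mk_param ::
    "nat \<Rightarrow> (nat \<Rightarrow> int) \<Rightarrow> (nat \<Rightarrow> int) \<Rightarrow> (nat \<Rightarrow> int) \<Rightarrow> int vec" where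
  "mk_param n a b c = vec (3 * n - 1) (\<lambda>i.
     if i < n then a (i + 1) else if i < 2 * n then b (i - n + 1) else c (i - 2 * n + 2))"

definition unit_cube :: "nat \<Rightarrow> (nat \<Rightarrow> real) set" where
  "unit_cube n = PiE {1..n} (\<lambda>_. {0..1})"

definition lebesgue_n :: "nat \<Rightarrow> (nat \<Rightarrow> real) measure" where
  "lebesgue_n n = PiM {1..n} (\<lambda>_. lborel)"

text \<open>
  Where a base vanishes (a null set of the cube) the value of the following expression is
  the arbitrary one given by \<open>0 powi m = 0\<close> for \<open>m < 0\<close> and \<open>x / 0 = 0\<close>.
\<close>

definition K_integrand :: "nat \<Rightarrow> int vec \<Rightarrow> (nat \<Rightarrow> real) \<Rightarrow> real" where
  "K_integrand n P y =
     (\<Prod>k=1..n. y k powi parA n P k * (1 - y k) powi parB n P k) /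
     (\<Prod>k=2..n. (1 - (\<Prod>j=1..k. y j)) powi (parC n P k + 1))"

definition K :: "nat \<Rightarrow> int vec \<Rightarrow> ennreal" where
  "K n P = (\<integral>\<^sup>+y\<in>unit_cube n. ennreal (K_integrand n P y) \<partial>lebesgue_n n)"


section \<open>The generating transformations\<close>

text \<open>
  The matrix of an endomorphism \<open>f\<close> of \<open>\<int>\<^sup>s\<close>; the three functions below are additive,
  and the lemmas after them confirm that their matrices act as they do.
\<close>

definition mat_of_fun :: "nat \<Rightarrow> (int vec \<Rightarrow> int vec) \<Rightarrow> int mat" where
  "mat_of_fun s f = mat s s (\<lambda>(i, j). vec_index (f (unit_vec s j)) i)"

text \<open>Exchange of \<open>y\<^sub>1\<close> and \<open>y\<^sub>2\<close>.\<close>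

definition sigma_fun :: "nat \<Rightarrow> int vec \<Rightarrow> int vec" where
  "sigma_fun n P = mk_param n
     (\<lambda>k. parA n P (Transposition.transpose 1 2 k))
     (\<lambda>k. parB n P (Transposition.transpose 1 2 k))
     (parC n P)"

text \<open>
  Euler's integral representation of \<open>\<^sub>2F\<^sub>1(C\<^sub>n + 1, A\<^sub>n + 1; A\<^sub>n + B\<^sub>n + 2; y\<^sub>1\<cdots>y\<^sub>n\<^sub>-\<^sub>1)\<close> by an
  integral in \<open>y\<^sub>n\<close>, and the symmetry of \<open>\<^sub>2F\<^sub>1\<close> in its first two arguments.
\<close>

definition chi_fun :: "nat \<Rightarrow> int vec \<Rightarrow> int vec" where
  "chi_fun n P = mk_param n
     ((parA n P)(n := parC n P n))
     ((parB n P)(n := parA n P n + parB n P n - parC n P n))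
     ((parC n P)(n := parA n P n))"

text \<open>
  Obtained from \<open>theta_map\<close> below: with \<open>t\<^sub>k = y\<^sub>1\<cdots>y\<^sub>k\<close> the latter is \<open>t'\<^sub>k = 1 - t\<^sub>n\<^sub>+\<^sub>1\<^sub>-\<^sub>k\<close>.
\<close>

definition theta_fun :: "nat \<Rightarrow> int vec \<Rightarrow> int vec" where
  "theta_fun n P = mk_param n
     (\<lambda>k. (\<Sum>m=1..n + 1 - k. parB n P m) - (\<Sum>m=2..n + 1 - k. parC n P m))
     (\<lambda>k. if k = 1 then parA n P n else parB n P (n + 2 - k))
     (\<lambda>k. parA n P (n + 2 - k) + parB n P (n + 2 - k) - parA n P (n + 1 - k))"

definition sigma_mat :: "nat \<Rightarrow> int mat" where
  "sigma_mat n = mat_of_fun (3 * n - 1) (sigma_fun n)"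

definition chi_mat :: "nat \<Rightarrow> int mat" where
  "chi_mat n = mat_of_fun (3 * n - 1) (chi_fun n)"

definition theta_mat :: "nat \<Rightarrow> int mat" where
  "theta_mat n = mat_of_fun (3 * n - 1) (theta_fun n)"

definition sigma_map :: "nat \<Rightarrow> (nat \<Rightarrow> real) \<Rightarrow> (nat \<Rightarrow> real)" where
  "sigma_map n y = (\<lambda>k\<in>{1..n}. y (Transposition.transpose 1 2 k))"

definition theta_map :: "nat \<Rightarrow> (nat \<Rightarrow> real) \<Rightarrow> (nat \<Rightarrow> real)" where
  "theta_map n y = (let y0 = y(n + 1 := 0) in
     (\<lambda>k\<in>{1..n}. (1 - (\<Prod>j=1..n - k + 1. y0 j)) / (1 - (\<Prod>j=1..n - k + 2. y0 j))))"

text \<open>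
  The substitution \<open>y' = \<phi> y\<close> transforms the differential form integrated in \<open>K(P)\<close> into
  the one integrated in \<open>K(g P)\<close>, for all \<open>P\<close>; stated for the corresponding measures,
  which absorbs the Jacobian.
\<close>

definition K_measure :: "nat \<Rightarrow> int vec \<Rightarrow> (nat \<Rightarrow> real) measure" where
  "K_measure n P =
     density (lebesgue_n n) (\<lambda>y. ennreal (K_integrand n P y) * indicator (unit_cube n) y)"

definition induced_by_change_of_variables ::
    "nat \<Rightarrow> int mat \<Rightarrow> ((nat \<Rightarrow> real) \<Rightarrow> (nat \<Rightarrow> real)) \<Rightarrow> bool" where
  "induced_by_change_of_variables n g \<phi> \<longleftrightarrow>
     \<phi> \<in> measurable (lebesgue_n n) (lebesgue_n n) \<and>
     (\<forall>P\<in>carrier_vec (3 * n - 1).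
        distr (K_measure n P) (lebesgue_n n) \<phi> = K_measure n (g *\<^sub>v P))"

text \<open>
  The hypergeometric identity, for the inner integral in \<open>y\<^sub>n\<close> with \<open>y\<^sub>1, \<dots>, y\<^sub>n\<^sub>-\<^sub>1\<close> fixed.
\<close>

definition hypergeometric_in_last_variable :: "nat \<Rightarrow> int mat \<Rightarrow> bool" where
  "hypergeometric_in_last_variable n g \<longleftrightarrow>
     (\<forall>P\<in>carrier_vec (3 * n - 1). \<forall>y.
        let a = parA n P n; b = parB n P n; c = parC n P n in
        0 \<le> a \<and> 0 \<le> b \<and> 0 \<le> c \<and> c \<le> a + b \<and> (\<forall>k\<in>{1..<n}. 0 < y k \<and> y k < 1) \<longrightarrow>
        ennreal (fact (nat c) * fact (nat (a + b - c))) *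
          (\<integral>\<^sup>+t\<in>{0..1}. ennreal (K_integrand n P (y(n := t))) \<partial>lborel) =
        ennreal (fact (nat a) * fact (nat b)) *
          (\<integral>\<^sup>+t\<in>{0..1}. ennreal (K_integrand n (g *\<^sub>v P) (y(n := t))) \<partial>lborel))"

lemma mat_of_fun_mult_vec:
  assumes car: "\<And>v. f v \<in> carrier_vec s"
    and add: "\<And>v w. v \<in> carrier_vec s \<Longrightarrow> w \<in> carrier_vec s \<Longrightarrow> f (v + w) = f v + f w"
    and smult: "\<And>c v. v \<in> carrier_vec s \<Longrightarrow> f (c \<cdot>\<^sub>v v) = c \<cdot>\<^sub>v f v"
    and v: "v \<in> carrier_vec s"
  shows "mat_of_fun s f *\<^sub>v v = f v"
proof -
  define w where "w m = vec s (\<lambda>i. if i < m then vec_index v i else 0)" for m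
  have w_car: "w m \<in> carrier_vec s" for m by (simp add: w_def)
  have dim: "dim_vec (f u) = s" for u using car[of u] by simp
  have *: "vec_index (f (w m)) i = (\<Sum>j<m. vec_index (f (unit_vec s j)) i * vec_index v j)"
    if "m \<le> s" "i < s" for m i
    using that
  proof (induction m)
    case 0
    have "w 0 = 0 \<cdot>\<^sub>v w 0" by (auto simp: w_def)
    then have "f (w 0) = 0 \<cdot>\<^sub>v f (w 0)" using smult[OF w_car[of 0], of 0] by simp
    then have "vec_index (f (w 0)) i = vec_index (0 \<cdot>\<^sub>v f (w 0)) i" by simp
    also have "\<dots> = 0" using dim 0 by simp
    finally show ?case by simp
  next
    case (Suc m)
    have "w (Suc m) = w m + vec_index v m \<cdot>\<^sub>v unit_vec s m"
      using Suc.prems by (auto simp: w_def less_Suc_eq)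
    then have "f (w (Suc m)) = f (w m) + vec_index v m \<cdot>\<^sub>v f (unit_vec s m)"
      using add[OF w_car] smult by simp
    then show ?case using Suc dim by simp
  qed
  have "w s = v" using v by (auto simp: w_def)
  then show ?thesis using *[of s] v dim
    by (intro eq_vecI) (auto simp: mat_of_fun_def scalar_prod_def row_def atLeast0LessThan)
qed

lemma sigma_mat_mult_vec:
  assumes "2 \<le> n" "P \<in> carrier_vec (3 * n - 1)"
  shows "sigma_mat n *\<^sub>v P = sigma_fun n P"
  unfolding sigma_mat_def
  by (rule mat_of_fun_mult_vec)
    (use assms in \<open>auto simp: sigma_fun_def mk_param_def parA_def parB_def parC_def Transposition.transpose_def
      algebra_simps\<close>)

lemma chi_mat_mult_vec:
  assumes "2 \<le> n" "P \<in> carrier_vec (3 * n - 1)"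
  shows "chi_mat n *\<^sub>v P = chi_fun n P"
  unfolding chi_mat_def
  by (rule mat_of_fun_mult_vec)
    (use assms in \<open>auto simp: chi_fun_def mk_param_def parA_def parB_def parC_def algebra_simps\<close>)

lemma parB_sum_linear:
  assumes "v \<in> carrier_vec (3 * n - 1)" "w \<in> carrier_vec (3 * n - 1)" "r \<le> n"
  shows "(\<Sum>m=1..r. parB n (v + w) m) = (\<Sum>m=1..r. parB n v m) + (\<Sum>m=1..r. parB n w m)"
    and "(\<Sum>m=1..r. parB n (c \<cdot>\<^sub>v v) m) = c * (\<Sum>m=1..r. parB n v m)"
  unfolding sum.distrib[symmetric] sum_distrib_left
  by (rule sum.cong; use assms in \<open>auto simp: parB_def\<close>)+

lemma parC_sum_linear:
  assumes "v \<in> carrier_vec (3 * n - 1)" "w \<in> carrier_vec (3 * n - 1)" "r \<le> n"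
  shows "(\<Sum>m=2..r. parC n (v + w) m) = (\<Sum>m=2..r. parC n v m) + (\<Sum>m=2..r. parC n w m)"
    and "(\<Sum>m=2..r. parC n (c \<cdot>\<^sub>v v) m) = c * (\<Sum>m=2..r. parC n v m)"
  unfolding sum.distrib[symmetric] sum_distrib_left
  by (rule sum.cong; use assms in \<open>auto simp: parC_def\<close>)+

lemma theta_mat_mult_vec:
  assumes "2 \<le> n" "P \<in> carrier_vec (3 * n - 1)"
  shows "theta_mat n *\<^sub>v P = theta_fun n P"
  unfolding theta_mat_def
proof (rule mat_of_fun_mult_vec)
  fix v w :: "int vec" and c :: int
  assume v: "v \<in> carrier_vec (3 * n - 1)"
  show "theta_fun n (c \<cdot>\<^sub>v v) = c \<cdot>\<^sub>v theta_fun n v"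
    unfolding theta_fun_def mk_param_def
    by (rule eq_vecI)
      (use assms v in \<open>auto simp: parB_sum_linear(2)[OF v v] parC_sum_linear(2)[OF v v]
         right_diff_distrib distrib_left simp del: One_nat_def\<close>,
       (auto simp: parA_def parB_def algebra_simps)?)
  assume w: "w \<in> carrier_vec (3 * n - 1)"
  show "theta_fun n (v + w) = theta_fun n v + theta_fun n w"
    unfolding theta_fun_def mk_param_def
    by (rule eq_vecI)
      (use assms v w in \<open>auto simp: parB_sum_linear(1)[OF v w] parC_sum_linear(1)[OF v w]
         simp del: One_nat_def\<close>,
       (auto simp: parA_def parB_def algebra_simps)?)
qed (use assms in \<open>auto simp: theta_fun_def mk_param_def\<close>)


section \<open>The abstract group\<close>

definition semidirect_product ::
    "('a, 'c) monoid_scheme \<Rightarrow> ('b, 'd) monoid_scheme \<Rightarrow> ('b \<Rightarrow> 'a \<Rightarrow> 'a) \<Rightarrow> ('a \<times> 'b) monoid" where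
  "semidirect_product N H act =
     \<lparr>carrier = carrier N \<times> carrier H,
      monoid.mult = (\<lambda>(x, h) (x', h'). (x \<otimes>\<^bsub>N\<^esub> act h x', h \<otimes>\<^bsub>H\<^esub> h')),
      one = (\<one>\<^bsub>N\<^esub>, \<one>\<^bsub>H\<^esub>)\<rparr>"

definition klein_group :: "(int \<times> int) monoid" where
  "klein_group = integer_mod_group 2 \<times>\<times> integer_mod_group 2"

definition swap_action :: "int \<Rightarrow> 'a \<times> 'a \<Rightarrow> 'a \<times> 'a" where
  "swap_action h x = (if h = 0 then x else prod.swap x)"

end

theory Submission
  imports Defs
begin

text \<open>
  Let \<open>s\<close>, \<open>c\<close>, \<open>h\<close> be the involutions \<open>\<sigma>\<close>, \<open>\<chi>\<close>, \<open>\<theta>\<close>. The elements \<open>s\<close> and \<open>h c h\<close> act on the variables at one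
  end, \<open>h s h\<close> and \<open>c\<close> at the other end; for \<open>n \<ge> 3\<close> the two pairs generate commuting Klein groups,
  which \<open>h\<close> exchanges. In the coordinates \<open>t\<^sub>k = y\<^sub>1\<cdots>y\<^sub>k\<close> the integrand is a product of powers of \<open>t\<^sub>k\<close>,
  \<open>t\<^sub>k\<^sub>-\<^sub>1 - t\<^sub>k\<close> and \<open>1 - t\<^sub>k\<close> on the simplex \<open>1 > t\<^sub>1 > \<cdots> > t\<^sub>n > 0\<close>, and in their exponents all
  generators act by simple local rules: \<open>\<theta>\<close>, induced by \<open>t\<^sub>k \<mapsto> 1 - t\<^sub>n\<^sub>+\<^sub>1\<^sub>-\<^sub>k\<close>, merely mirrors them.

  The maps \<open>\<sigma>\<close> and \<open>\<theta>\<close> preserve \<open>K\<close>, and every group element acts on \<open>K\<close> like \<open>1\<close>, \<open>c\<close>, \<open>h c h\<close> or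
  \<open>(h c h) c\<close>. Convergence of \<open>K P\<close> forces \<open>A\<^sub>n, B\<^sub>n \<ge> 0\<close>. As \<open>h c h\<close> fixes \<open>A\<^sub>n\<close> and \<open>B\<^sub>n\<close>, convergence at \<open>P\<close>
  and at \<open>(h c h) c P\<close> gives the nonnegativity conditions under which the hypergeometric identity
  relates \<open>K P\<close> and \<open>K (c P)\<close>, so the intermediate integral is finite as well. No criterion for
  convergence is needed.
\<close>

section \<open>Euler integrals in one variable\<close>

declare One_nat_def [simp del]

text \<open>Newton's series with exponent \<open>- (c + 1)\<close>: upper negation turns its
  coefficients into ordinary binomials, and the sign cancels against that of
  \<open>(- z) ^ m\<close>.\<close>

lemma negative_binomial_sums:
  fixes z :: real
  assumes "\<bar>z\<bar> < 1"
  shows "(\<lambda>m. real ((c + m) choose m) * z ^ m) sums (1 / (1 - z) ^ (c + 1))"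
proof -
  have "(\<lambda>m. ((- real (c + 1)) gchoose m) * (- z) ^ m) sums (1 + - z) powr (- real (c + 1))"
    by (rule gen_binomial_real) (use assms in simp)
  moreover have "((- real (c + 1)) gchoose m) * (- z) ^ m = real ((c + m) choose m) * z ^ m" for m
  proof -
    have "(- real (c + 1)) gchoose m = (-1) ^ m * (real (c + m) gchoose m)"
      by (subst gbinomial_minus) (simp add: algebra_simps)
    then show ?thesis
      by (simp add: binomial_gbinomial power_mult_distrib[symmetric] mult.commute[of _ "(- z) ^ m"]
          mult.assoc[symmetric])
  qed
  moreover have "(1 + - z) powr (- real (c + 1)) = 1 / (1 - z) ^ (c + 1)"
    using assms by (simp only: powr_minus powr_realpow) (simp add: divide_inverse powr_realpow)
  ultimately show ?thesis by simp
qed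

lemma nn_integral_beta:
  "(\<integral>\<^sup>+t\<in>{0..1}. ennreal (t ^ a * (1 - t) ^ b) \<partial>lborel) = ennreal (fact a * fact b / fact (a + b + 1))"
proof (rule nn_integral_has_integral_lebesgue')
  have "((\<lambda>t. t powr (real (a + 1) - 1) * (1 - t) powr (real (b + 1) - 1)) has_integral
      Beta (real (a + 1)) (real (b + 1))) {0..1}"
    by (rule has_integral_Beta_real) simp_all
  also have "Beta (real (a + 1)) (real (b + 1)) = fact a * fact b / fact (a + b + 1)"
    using Gamma_fact[of a, where 'a = real] Gamma_fact[of b, where 'a = real]
      Gamma_fact[of "a + b + 1", where 'a = real]
    by (simp add: Beta_def add_ac)
  finally have "((\<lambda>t. t powr (real (a + 1) - 1) * (1 - t) powr (real (b + 1) - 1)) has_integral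
      (fact a * fact b / fact (a + b + 1))) {0..1}" .
  \<comment> \<open>At the endpoints \<open>0 powr 0 = 0\<close> may differ from
    \<open>0 ^ 0 = 1\<close>; two points do not affect the integral.\<close>
  then show "((\<lambda>t. t ^ a * (1 - t) ^ b) has_integral (fact a * fact b / fact (a + b + 1))) {0..1::real}"
    by (rule has_integral_spike_finite[of "{0, 1}", rotated 2]) (auto simp: powr_realpow)
qed auto

text \<open>Expansion of \<open>1 / (1 - x * t) ^ (c + 1)\<close> in powers of \<open>x * t\<close>,
  then a beta integral in each term. All terms are nonnegative, which justifies exchanging sum and
  integral; \<open>x < 1\<close> keeps the series convergent up to \<open>t = 1\<close>.\<close>

lemma nn_integral_euler_series:
  assumes "0 \<le> x" "x < 1"
  shows "(\<integral>\<^sup>+t\<in>{0..1}. ennreal (t ^ a * (1 - t) ^ b / (1 - x * t) ^ (c + 1)) \<partial>lborel) =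
    (\<Sum>m. ennreal (real ((c + m) choose m) * x ^ m * (fact (a + m) * fact b / fact (a + m + b + 1))))"
proof -
  have "(\<integral>\<^sup>+t\<in>{0..1}. ennreal (t ^ a * (1 - t) ^ b / (1 - x * t) ^ (c + 1)) \<partial>lborel) =
     (\<integral>\<^sup>+t. (\<Sum>m. ennreal (real ((c + m) choose m) * x ^ m) *
        (ennreal (t ^ (a + m) * (1 - t) ^ b) * indicator {0..1} t)) \<partial>lborel)"
  proof (rule nn_integral_cong)
    fix t :: real
    show "ennreal (t ^ a * (1 - t) ^ b / (1 - x * t) ^ (c + 1)) * indicator {0..1} t =
      (\<Sum>m. ennreal (real ((c + m) choose m) * x ^ m) * (ennreal (t ^ (a + m) * (1 - t) ^ b) * indicator {0..1} t))"
    proof (cases "t \<in> {0..1}")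
      case True
      have "x * t \<le> x" using True assms by (simp add: mult_left_le)
      then have "\<bar>x * t\<bar> < 1" using True assms by simp
      then have "(\<lambda>m. t ^ a * (1 - t) ^ b * (real ((c + m) choose m) * (x * t) ^ m)) sums
         (t ^ a * (1 - t) ^ b * (1 / (1 - x * t) ^ (c + 1)))"
        by (intro sums_mult negative_binomial_sums)
      then have "(\<Sum>m. ennreal (t ^ a * (1 - t) ^ b * (real ((c + m) choose m) * (x * t) ^ m))) =
          ennreal (t ^ a * (1 - t) ^ b * (1 / (1 - x * t) ^ (c + 1)))"
        using True assms by (intro suminf_ennreal_eq) auto
      moreover have "ennreal (t ^ a * (1 - t) ^ b * (real ((c + m) choose m) * (x * t) ^ m)) =
          ennreal (real ((c + m) choose m) * x ^ m) * ennreal (t ^ (a + m) * (1 - t) ^ b)" for m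
        using True assms
        by (subst ennreal_mult[symmetric]) (auto simp: power_add power_mult_distrib mult_ac)
      ultimately show ?thesis using True by simp
    qed simp
  qed
  also have "\<dots> = (\<Sum>m. ennreal (real ((c + m) choose m) * x ^ m) *
      (\<integral>\<^sup>+t\<in>{0..1}. ennreal (t ^ (a + m) * (1 - t) ^ b) \<partial>lborel))"
    by (simp add: nn_integral_suminf nn_integral_cmult)
  also have "\<dots> = (\<Sum>m. ennreal (real ((c + m) choose m) * x ^ m * (fact (a + m) * fact b / fact (a + m + b + 1))))"
    unfolding nn_integral_beta using assms by (intro suminf_cong ennreal_mult[symmetric]) auto
  finally show ?thesis .
qed

text \<open>With the constant included, the coefficient of \<open>x ^ m\<close> on the left is b! d!
  (a+m)! (c+m)! / (m! (a+b+m+1)!). Exchanging (a, b) with (c, d) preserves it because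
  \<open>a + b = c + d\<close>. This is the symmetry of 2F1 in its first two arguments.\<close>

lemma euler_integral_symmetry:
  assumes x: "0 \<le> x" "x < 1" and sum: "a + b = c + d"
  shows "ennreal (fact c * fact d) *
      (\<integral>\<^sup>+t\<in>{0..1}. ennreal (t ^ a * (1 - t) ^ b / (1 - x * t) ^ (c + 1)) \<partial>lborel) =
    ennreal (fact a * fact b) *
      (\<integral>\<^sup>+t\<in>{0..1}. ennreal (t ^ c * (1 - t) ^ d / (1 - x * t) ^ (a + 1)) \<partial>lborel)"
proof -
  have binom: "real ((i + m) choose m) = fact (i + m) / (fact m * fact i)" for i m
    using binomial_fact[of m "i + m", where 'a = real] by simp
  have "fact c * fact d * (real ((c + m) choose m) * x ^ m * (fact (a + m) * fact b / fact (a + m + b + 1))) =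
     fact a * fact b * (real ((a + m) choose m) * x ^ m * (fact (c + m) * fact d / fact (c + m + d + 1)))" for m
  proof -
    have "fact (a + m + b + 1) = (fact (c + m + d + 1) :: real)"
      using sum by (intro arg_cong[where f = fact]) simp
    then show ?thesis unfolding binom by (simp only:) (simp add: field_simps)
  qed
  then have "ennreal (fact c * fact d) * ennreal (real ((c + m) choose m) * x ^ m * (fact (a + m) * fact b / fact (a + m + b + 1))) =
     ennreal (fact a * fact b) * ennreal (real ((a + m) choose m) * x ^ m * (fact (c + m) * fact d / fact (c + m + d + 1)))" for m
    using x by (simp add: ennreal_mult[symmetric])
  then show ?thesis
    unfolding nn_integral_euler_series[OF x] by (simp only: ennreal_suminf_cmult[symmetric])
qed

section \<open>Divergence at an endpoint with a negative exponent\<close>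

lemma nn_integral_inverse_at_0:
  "(\<integral>\<^sup>+t\<in>{0<..<1/2::real}. ennreal (1 / t) \<partial>lborel) = \<infinity>"
proof -
  define I where "I b = (\<integral>\<^sup>+t. ennreal (1 / t) * indicator {0<..<b} t \<partial>lborel)" for b :: real
  \<comment> \<open>The measure dt / t is invariant under halving of t.\<close>
  have I: "I (1/2) = I 1"
  proof -
    have "I (1/2) = ennreal \<bar>1/2\<bar> * (\<integral>\<^sup>+t. ennreal (1 / (0 + 1/2 * t)) * indicator {0<..<1/2} (0 + 1/2 * t) \<partial>lborel)"
      unfolding I_def by (rule nn_integral_real_affine) auto
    also have "\<dots> = (\<integral>\<^sup>+t. ennreal (1/2) * (ennreal (1 / (0 + 1/2 * t)) * indicator {0<..<1/2} (0 + 1/2 * t)) \<partial>lborel)"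
      by (subst nn_integral_cmult) auto
    also have "\<dots> = I 1"
      unfolding I_def
      by (intro nn_integral_cong, subst mult.assoc[symmetric], subst ennreal_mult'[symmetric])
        (auto simp: indicator_def)
    finally show ?thesis .
  qed
  \<comment> \<open>On the remaining interval of length 1/2 the integrand is at least 1. Together
    with the invariance, \<open>I (1/2)\<close> absorbs a positive summand, hence is
    infinite.\<close>
  have "I (1/2) + ennreal (1/2) \<le> I 1"
  proof -
    have "ennreal (1/2) = (\<integral>\<^sup>+t. indicator {1/2..<1::real} t \<partial>lborel)"
      by simp
    then have "I (1/2) + ennreal (1/2) =
        (\<integral>\<^sup>+t. ennreal (1 / t) * indicator {0<..<1/2} t + indicator {1/2..<1} t \<partial>lborel)"
      unfolding I_def by (subst nn_integral_add) auto
    also have "\<dots> \<le> I 1"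
      unfolding I_def by (intro nn_integral_mono) (auto simp: indicator_def)
    finally show ?thesis .
  qed
  then have "I (1/2) = \<infinity>"
    unfolding I[symmetric] by (cases "I (1/2)") (auto simp: ennreal_plus[symmetric] simp del: ennreal_plus)
  then show ?thesis by (simp add: I_def)
qed

lemma powi_borel_measurable [measurable]:
  fixes f :: "'a \<Rightarrow> real"
  assumes [measurable]: "f \<in> borel_measurable M"
  shows "(\<lambda>x. f x powi m) \<in> borel_measurable M"
  unfolding power_int_def by (cases "m \<ge> 0") auto

text \<open>On the compact interval \<open>{0..1/2}\<close> the positive function \<open>h\<close>
  has a positive minimum, and \<open>t powi a\<close> is at least \<open>1 / t\<close> for 0 < t <
  1/2 because the integer \<open>a\<close> is at most -1.\<close>

lemma nn_integral_pole_at_0: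
  fixes h :: "real \<Rightarrow> real"
  assumes [measurable]: "h \<in> borel_measurable borel"
    and cont: "continuous_on {0..1/2} h" and pos: "\<And>t. t \<in> {0..1/2} \<Longrightarrow> 0 < h t" and "a < 0"
  shows "(\<integral>\<^sup>+t\<in>{0<..<1}. ennreal (t powi a * h t) \<partial>lborel) = \<infinity>"
proof -
  obtain u where u: "u \<in> {0..1/2}" "\<And>t. t \<in> {0..1/2} \<Longrightarrow> h u \<le> h t"
    using continuous_attains_inf[OF _ _ cont] by auto
  have "\<infinity> = ennreal (h u) * (\<integral>\<^sup>+t\<in>{0<..<1/2}. ennreal (1 / t) \<partial>lborel)"
    unfolding nn_integral_inverse_at_0 using pos[OF u(1)] by (simp add: ennreal_mult_eq_top_iff)
  also have "\<dots> = (\<integral>\<^sup>+t. ennreal (h u) * (ennreal (1 / t) * indicator {0<..<1/2} t) \<partial>lborel)"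
    by (subst nn_integral_cmult) auto
  also have "\<dots> \<le> (\<integral>\<^sup>+t\<in>{0<..<1}. ennreal (t powi a * h t) \<partial>lborel)"
  proof (rule nn_integral_mono)
    fix t :: real
    have "ennreal (h u) * ennreal (1 / t) \<le> ennreal (t powi a * h t)" if t: "t \<in> {0<..<1/2}"
    proof -
      have "t powi (-1) \<le> t powi a"
        using t \<open>a < 0\<close> by (intro power_int_decreasing) auto
      then have "1 / t \<le> t powi a" using t by (simp add: power_int_minus field_simps)
      moreover have "h u \<le> h t" using u t by auto
      ultimately have "h u * (1 / t) \<le> h t * t powi a"
        using pos[of t] t by (intro mult_mono) auto
      then show ?thesis
        using pos[OF u(1)] t by (subst ennreal_mult[symmetric]) (auto intro!: ennreal_leI simp: mult.commute)
    qed
    then show "ennreal (h u) * (ennreal (1 / t) * indicator {0<..<1/2} t)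
      \<le> ennreal (t powi a * h t) * indicator {0<..<1} t"
      by (auto simp: indicator_def mult.assoc[symmetric])
  qed
  finally show ?thesis by (simp add: top_unique)
qed

text \<open>The reflection of t to 1 - t moves the pole to 0.\<close>

lemma nn_integral_pole_at_1:
  fixes h :: "real \<Rightarrow> real"
  assumes [measurable]: "h \<in> borel_measurable borel"
    and cont: "continuous_on {1/2..1} h" and pos: "\<And>t. t \<in> {1/2..1} \<Longrightarrow> 0 < h t" and "b < 0"
  shows "(\<integral>\<^sup>+t\<in>{0<..<1}. ennreal ((1 - t) powi b * h t) \<partial>lborel) = \<infinity>"
proof -
  have "(\<integral>\<^sup>+t\<in>{0<..<1}. ennreal ((1 - t) powi b * h t) \<partial>lborel) =
    ennreal \<bar>- 1\<bar> * (\<integral>\<^sup>+t. ennreal ((1 - (1 + -1 * t)) powi b * h (1 + -1 * t)) * indicator {0<..<1} (1 + -1 * t) \<partial>lborel)"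
    by (rule nn_integral_real_affine) auto
  also have "\<dots> = (\<integral>\<^sup>+t\<in>{0<..<1}. ennreal (t powi b * h (1 - t)) \<partial>lborel)"
    by (auto intro!: nn_integral_cong simp: indicator_def)
  also have "\<dots> = \<infinity>"
  proof (rule nn_integral_pole_at_0)
    show "continuous_on {0..1/2} (\<lambda>t. h (1 - t))"
      by (rule continuous_on_compose2[OF cont]) (auto intro!: continuous_intros)
  qed (use pos \<open>b < 0\<close> in auto)
  finally show ?thesis .
qed

lemma nn_integral_Icc_Ioo:
  fixes f :: "real \<Rightarrow> ennreal"
  shows "(\<integral>\<^sup>+t\<in>{0..1}. f t \<partial>lborel) = (\<integral>\<^sup>+t\<in>{0<..<1}. f t \<partial>lborel)"
proof (rule nn_integral_cong_AE)
  show "AE t in lborel. f t * indicator {0..1} t = f t * indicator {0<..<1} t"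
    using AE_lborel_singleton[of "0::real"] AE_lborel_singleton[of "1::real"]
    by eventually_elim (auto simp: indicator_def)
qed

section \<open>The wreath product of the Klein group by an involution\<close>

text \<open>The power of an involution by a bit; the integers 0 and 1 are the elements of
  \<open>integer_mod_group 2\<close>.\<close>

definition bitpow :: "('a, 'b) monoid_scheme \<Rightarrow> 'a \<Rightarrow> int \<Rightarrow> 'a" where
  "bitpow G x i = (if i = 0 then \<one>\<^bsub>G\<^esub> else x)"

lemma carrier_bit: "carrier (integer_mod_group 2) = {0, 1}"
  by (auto simp: carrier_integer_mod_group)

abbreviation wreath :: "(((int \<times> int) \<times> int \<times> int) \<times> int) monoid" where
  "wreath \<equiv> semidirect_product (klein_group \<times>\<times> klein_group) (integer_mod_group 2) swap_action"

lemma carrier_wreath: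
  "carrier wreath = (({0, 1} \<times> {0, 1}) \<times> {0, 1} \<times> {0, 1}) \<times> {0, 1}"
  by (simp add: semidirect_product_def klein_group_def carrier_bit)

lemma mult_wreath:
  "((x, y), e) \<otimes>\<^bsub>wreath\<^esub> ((x', y'), e') =
     ((if e = 0 then (x \<otimes>\<^bsub>klein_group\<^esub> x', y \<otimes>\<^bsub>klein_group\<^esub> y')
       else (x \<otimes>\<^bsub>klein_group\<^esub> y', y \<otimes>\<^bsub>klein_group\<^esub> x')), (e + e') mod 2)"
  by (auto simp: semidirect_product_def swap_action_def mult_integer_mod_group)

lemma mult_klein: "(a, b) \<otimes>\<^bsub>klein_group\<^esub> (a', b') = ((a + a') mod 2, (b + b') mod 2)"
  by (auto simp: klein_group_def mult_integer_mod_group)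

lemma mult_klein_closed: "p \<otimes>\<^bsub>klein_group\<^esub> q \<in> {0, 1} \<times> {0, 1}"
  unfolding mult_klein[of "fst p" "snd p" "fst q" "snd q", unfolded prod.collapse]
  using mod2_eq_if[of "fst p + fst q"] mod2_eq_if[of "snd p + snd q"] by auto

lemma mult_klein_self: "p \<in> {0, 1} \<times> {0, 1} \<Longrightarrow> p \<otimes>\<^bsub>klein_group\<^esub> p = (0, 0)"
  by (auto simp: mult_klein)

text \<open>Each component of a product is reduced modulo 2, so closure holds for arbitrary
  arguments.\<close>

lemma mult_wreath_closed: "z \<otimes>\<^bsub>wreath\<^esub> z' \<in> carrier wreath"
proof -
  obtain x y e x' y' e' where z: "z = ((x, y), e)" and z': "z' = ((x', y'), e')"
    by (metis prod.collapse)
  have "(e + e') mod 2 \<in> {0, 1}"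
    using mod2_eq_if[of "e + e'"] by auto
  then show ?thesis
    unfolding carrier_wreath z z' mult_wreath
    by (cases "e = 0") (simp_all only: if_True if_False simp_thms mem_Sigma_iff mult_klein_closed)
qed

section \<open>Products of commuting involutions\<close>

context group
begin

lemma interchange:
  assumes "x \<in> carrier G" "y \<in> carrier G" "x' \<in> carrier G" "y' \<in> carrier G" "y \<otimes> x' = x' \<otimes> y"
  shows "(x \<otimes> y) \<otimes> (x' \<otimes> y') = (x \<otimes> x') \<otimes> (y \<otimes> y')"
proof -
  have "(x \<otimes> y) \<otimes> (x' \<otimes> y') = x \<otimes> ((y \<otimes> x') \<otimes> y')"
    using assms(1-4) by (simp add: m_assoc)
  also have "\<dots> = x \<otimes> ((x' \<otimes> y) \<otimes> y')"
    by (simp add: assms(5))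
  also have "\<dots> = (x \<otimes> x') \<otimes> (y \<otimes> y')"
    using assms(1-4) by (simp add: m_assoc)
  finally show ?thesis .
qed

lemma bitpow_closed [simp]: "x \<in> carrier G \<Longrightarrow> bitpow G x i \<in> carrier G"
  by (simp add: bitpow_def)

lemma bitpow_mult:
  assumes "x \<in> carrier G" "x \<otimes> x = \<one>" "i \<in> {0, 1}" "j \<in> {0, 1}"
  shows "bitpow G x i \<otimes> bitpow G x j = bitpow G x ((i + j) mod 2)"
  using assms by (auto simp: bitpow_def)

lemma bitpow_commute:
  assumes "x \<in> carrier G" "y \<in> carrier G" "x \<otimes> y = y \<otimes> x"
  shows "bitpow G x i \<otimes> bitpow G y j = bitpow G y j \<otimes> bitpow G x i"
  using assms by (auto simp: bitpow_def)

definition klein_map :: "'a \<Rightarrow> 'a \<Rightarrow> int \<times> int \<Rightarrow> 'a" where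
  "klein_map x y = (\<lambda>(a, b). bitpow G x a \<otimes> bitpow G y b)"

lemma klein_map_closed [simp]:
  "x \<in> carrier G \<Longrightarrow> y \<in> carrier G \<Longrightarrow> klein_map x y p \<in> carrier G"
  by (simp add: klein_map_def split: prod.splits)

lemma klein_map_mult:
  assumes "x \<in> carrier G" "y \<in> carrier G" "x \<otimes> x = \<one>" "y \<otimes> y = \<one>" "x \<otimes> y = y \<otimes> x"
    and "p \<in> {0, 1} \<times> {0, 1}" "q \<in> {0, 1} \<times> {0, 1}"
  shows "klein_map x y p \<otimes> klein_map x y q = klein_map x y (p \<otimes>\<^bsub>klein_group\<^esub> q)"
proof -
  obtain a b a' b' where p: "p = (a, b)" and q: "q = (a', b')" by fastforce
  have "klein_map x y p \<otimes> klein_map x y q =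
      (bitpow G x a \<otimes> bitpow G x a') \<otimes> (bitpow G y b \<otimes> bitpow G y b')"
    unfolding klein_map_def p q case_prod_conv
    by (rule interchange) (use assms bitpow_commute[of y x b a'] in auto)
  also have "\<dots> = klein_map x y (p \<otimes>\<^bsub>klein_group\<^esub> q)"
    using assms by (auto simp: bitpow_mult p q mult_klein klein_map_def)
  finally show ?thesis .
qed

lemma commute_mult_right:
  assumes "x \<in> carrier G" "y \<in> carrier G" "z \<in> carrier G" "x \<otimes> y = y \<otimes> x" "x \<otimes> z = z \<otimes> x"
  shows "x \<otimes> (y \<otimes> z) = (y \<otimes> z) \<otimes> x"
  using assms by (metis m_assoc)

lemma klein_map_commute:
  assumes "x \<in> carrier G" "y \<in> carrier G" "z \<in> carrier G" "w \<in> carrier G"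
    and "x \<otimes> z = z \<otimes> x" "y \<otimes> z = z \<otimes> y" "x \<otimes> w = w \<otimes> x" "y \<otimes> w = w \<otimes> y"
  shows "klein_map x y p \<otimes> klein_map z w q = klein_map z w q \<otimes> klein_map x y p"
proof -
  obtain a b c d where p: "p = (a, b)" and q: "q = (c, d)" by fastforce
  show ?thesis unfolding p q klein_map_def case_prod_conv
    by (rule commute_mult_right;
        (rule commute_mult_right[symmetric] bitpow_commute[symmetric] bitpow_commute)?)
      (use assms in \<open>auto intro!: bitpow_commute commute_mult_right[symmetric]\<close>)
qed

text \<open>One Klein factor goes to the group of \<open>s\<close> and h c h, the other to that of h
  s h and \<open>c\<close>. The generators are listed so that conjugation by \<open>h\<close>
  matches first with first and second with second, which makes \<open>h\<close> act by
  \<open>swap_action\<close>.\<close>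

definition wreath_map :: "'a \<Rightarrow> 'a \<Rightarrow> 'a \<Rightarrow> ((int \<times> int) \<times> int \<times> int) \<times> int \<Rightarrow> 'a" where
  "wreath_map s c h = (\<lambda>((x, y), e).
     klein_map s (h \<otimes> c \<otimes> h) x \<otimes> klein_map (h \<otimes> s \<otimes> h) c y \<otimes> bitpow G h e)"

end

section \<open>Three involutions satisfying the relations of the wreath product\<close>

locale klein_wreath_generators = group G for G (structure) +
  fixes s c h
  assumes closed [simp]: "s \<in> carrier G" "c \<in> carrier G" "h \<in> carrier G"
    and sq [simp]: "s \<otimes> s = \<one>" "c \<otimes> c = \<one>" "h \<otimes> h = \<one>"
    and commute: "s \<otimes> c = c \<otimes> s"
      "s \<otimes> (h \<otimes> s \<otimes> h) = (h \<otimes> s \<otimes> h) \<otimes> s"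
      "s \<otimes> (h \<otimes> c \<otimes> h) = (h \<otimes> c \<otimes> h) \<otimes> s"
      "c \<otimes> (h \<otimes> c \<otimes> h) = (h \<otimes> c \<otimes> h) \<otimes> c"
begin

abbreviation "r \<equiv> h \<otimes> s \<otimes> h"
abbreviation "t \<equiv> h \<otimes> c \<otimes> h"
abbreviation "\<phi> \<equiv> wreath_map s c h"

lemma cancel_h: "x \<in> carrier G \<Longrightarrow> h \<otimes> (h \<otimes> x) = x"
  by (simp add: m_assoc[symmetric])

lemma conj_mult:
  assumes "x \<in> carrier G" "y \<in> carrier G"
  shows "(h \<otimes> x \<otimes> h) \<otimes> (h \<otimes> y \<otimes> h) = h \<otimes> (x \<otimes> y) \<otimes> h"
  using assms by (simp add: m_assoc cancel_h)

lemma conj_conj: "x \<in> carrier G \<Longrightarrow> h \<otimes> (h \<otimes> x \<otimes> h) \<otimes> h = x"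
  by (simp add: m_assoc cancel_h)

lemma sq_conj [simp]: "r \<otimes> r = \<one>" "t \<otimes> t = \<one>"
  by (simp_all add: conj_mult)

text \<open>Conjugation by \<open>h\<close> exchanges \<open>s\<close> with \<open>r\<close> and
  \<open>c\<close> with \<open>t\<close>, so it turns the relations of \<open>s\<close> with
  \<open>t\<close> and with \<open>c\<close> into two further ones. With the assumptions, all of
  \<open>s\<close>, \<open>t\<close>, \<open>r\<close>, \<open>c\<close> then commute
  pairwise.\<close>

lemma commute_conj: "r \<otimes> c = c \<otimes> r" "t \<otimes> r = r \<otimes> t"
proof -
  have "h \<otimes> (s \<otimes> t) \<otimes> h = h \<otimes> (t \<otimes> s) \<otimes> h"
    using commute(3) by simp
  then have "r \<otimes> (h \<otimes> t \<otimes> h) = (h \<otimes> t \<otimes> h) \<otimes> r"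
    by (simp only: conj_mult closed m_closed)
  then show "r \<otimes> c = c \<otimes> r"
    by (simp only: conj_conj closed)
  show "t \<otimes> r = r \<otimes> t"
    by (simp only: conj_mult closed commute(1))
qed

lemma factors_commute: "klein_map s t p \<otimes> klein_map r c q = klein_map r c q \<otimes> klein_map s t p"
  by (rule klein_map_commute) (use commute commute_conj in auto)

lemma h_klein_map:
  "h \<otimes> klein_map s t p = klein_map r c p \<otimes> h" "h \<otimes> klein_map r c p = klein_map s t p \<otimes> h"
proof -
  have *: "h \<otimes> bitpow G x i \<otimes> h = bitpow G (h \<otimes> x \<otimes> h) i" if "x \<in> carrier G" for x i
    using that by (simp add: bitpow_def)
  have **: "h \<otimes> klein_map x y p \<otimes> h = klein_map (h \<otimes> x \<otimes> h) (h \<otimes> y \<otimes> h) p"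
    if "x \<in> carrier G" "y \<in> carrier G" for x y
    using that unfolding klein_map_def
    by (simp add: split_beta conj_mult[symmetric]) (simp add: *)
  have ***: "h \<otimes> x = (h \<otimes> x \<otimes> h) \<otimes> h" if "x \<in> carrier G" for x
    using that by (simp add: m_assoc)
  show "h \<otimes> klein_map s t p = klein_map r c p \<otimes> h"
    by (subst ***) (simp_all only: ** conj_conj closed m_closed klein_map_closed)
  show "h \<otimes> klein_map r c p = klein_map s t p \<otimes> h"
    by (subst ***) (simp_all only: ** conj_conj closed m_closed klein_map_closed)
qed

lemma wreath_map_closed [simp]: "\<phi> z \<in> carrier G"
  by (simp add: wreath_map_def split_beta)

text \<open>The crossed relation of the semidirect product: \<open>h\<close> moved to the right
  exchanges the exponents of the two Klein groups, after which \<open>factors_commute\<close>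
  restores their order.\<close>

lemma h_pow_factors:
  assumes "e \<in> {0, 1}"
  shows "bitpow G h e \<otimes> (klein_map s t x \<otimes> klein_map r c y) =
    (klein_map s t (if e = 0 then x else y) \<otimes> klein_map r c (if e = 0 then y else x)) \<otimes> bitpow G h e"
proof (cases "e = 0")
  case False
  have "h \<otimes> (klein_map s t x \<otimes> klein_map r c y) = (h \<otimes> klein_map s t x) \<otimes> klein_map r c y"
    by (simp add: m_assoc)
  also have "\<dots> = (klein_map r c x \<otimes> h) \<otimes> klein_map r c y"
    by (simp only: h_klein_map)
  also have "\<dots> = klein_map r c x \<otimes> (h \<otimes> klein_map r c y)"
    by (rule m_assoc) simp_all
  also have "\<dots> = klein_map r c x \<otimes> (klein_map s t y \<otimes> h)"
    by (simp only: h_klein_map)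
  also have "\<dots> = (klein_map r c x \<otimes> klein_map s t y) \<otimes> h"
    by (rule m_assoc[symmetric]) simp_all
  finally show ?thesis
    using False by (simp add: bitpow_def factors_commute)
qed (simp add: bitpow_def)

lemma wreath_map_mult:
  assumes "z \<in> carrier wreath" "z' \<in> carrier wreath"
  shows "\<phi> (z \<otimes>\<^bsub>wreath\<^esub> z') = \<phi> z \<otimes> \<phi> z'"
proof -
  obtain x y e x' y' e' where z: "z = ((x, y), e)" and z': "z' = ((x', y'), e')"
    by (metis prod.collapse)
  define x'' y'' where "x'' = (if e = 0 then x' else y')" and "y'' = (if e = 0 then y' else x')"
  let ?V = "klein_map s t" and ?W = "klein_map r c"
  have mem: "x \<in> {0,1} \<times> {0,1}" "y \<in> {0,1} \<times> {0,1}" "x'' \<in> {0,1} \<times> {0,1}" "y'' \<in> {0,1} \<times> {0,1}"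
      "e \<in> {0,1}" "e' \<in> {0,1}"
    using assms by (auto simp: carrier_wreath z z' x''_def y''_def)
  have "\<phi> z \<otimes> \<phi> z' = (?V x \<otimes> ?W y) \<otimes> (bitpow G h e \<otimes> (?V x' \<otimes> ?W y')) \<otimes> bitpow G h e'"
    by (simp add: wreath_map_def z z' m_assoc)
  also have "\<dots> = ((?V x \<otimes> ?W y) \<otimes> (?V x'' \<otimes> ?W y'')) \<otimes> (bitpow G h e \<otimes> bitpow G h e')"
    by (simp only: h_pow_factors[OF mem(5)] x''_def[symmetric] y''_def[symmetric]) (simp add: m_assoc)
  also have "(?V x \<otimes> ?W y) \<otimes> (?V x'' \<otimes> ?W y'') = (?V x \<otimes> ?V x'') \<otimes> (?W y \<otimes> ?W y'')"
    by (rule interchange) (simp_all add: factors_commute)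
  also have "?V x \<otimes> ?V x'' = ?V (x \<otimes>\<^bsub>klein_group\<^esub> x'')"
    by (rule klein_map_mult) (use mem commute in simp_all)
  also have "?W y \<otimes> ?W y'' = ?W (y \<otimes>\<^bsub>klein_group\<^esub> y'')"
    by (rule klein_map_mult) (use mem commute_conj in simp_all)
  also have "bitpow G h e \<otimes> bitpow G h e' = bitpow G h ((e + e') mod 2)"
    by (rule bitpow_mult) (use mem in simp_all)
  finally show ?thesis
    by (simp add: z z' mult_wreath wreath_map_def x''_def y''_def)
qed

lemma wreath_map_one: "\<phi> (((0, 0), 0, 0), 0) = \<one>"
  by (simp add: wreath_map_def klein_map_def bitpow_def)

lemma wreath_map_generators:
  "\<phi> (((1, 0), 0, 0), 0) = s" "\<phi> (((0, 0), 0, 1), 0) = c" "\<phi> (((0, 0), 0, 0), 1) = h"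
  by (simp_all add: wreath_map_def klein_map_def bitpow_def)

lemma subgroup_wreath_map: "subgroup (\<phi> ` carrier wreath) G"
proof (rule subgroupI)
  show "\<phi> ` carrier wreath \<noteq> {}" by (auto simp: carrier_wreath)
next
  fix g assume "g \<in> \<phi> ` carrier wreath"
  then obtain x y e where z: "((x, y), e) \<in> carrier wreath" and g: "g = \<phi> ((x, y), e)"
    by (elim imageE) (metis (no_types) prod.collapse)
  \<comment> \<open>The inverse, written down explicitly: elements of a Klein group are their own
    inverses, and for \<open>e = 1\<close> the swap in the multiplication has to be undone.\<close>
  define z' where "z' = (if e = 0 then (x, y) else (y, x), e)"
  have mem: "x \<in> {0, 1} \<times> {0, 1}" "y \<in> {0, 1} \<times> {0, 1}" "e \<in> {0, 1}"
    using z by (simp_all only: carrier_wreath mem_Sigma_iff)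
  then have "(e + e) mod 2 = 0" by auto
  then have "((x, y), e) \<otimes>\<^bsub>wreath\<^esub> z' = (((0, 0), 0, 0), 0)"
    using mem by (simp add: z'_def mult_wreath mult_klein_self del: mem_Sigma_iff)
  moreover have z': "z' \<in> carrier wreath"
    unfolding z'_def carrier_wreath using mem
    by (cases "e = 0") (simp_all only: if_True if_False simp_thms mem_Sigma_iff)
  ultimately have "g \<otimes> \<phi> z' = \<one>"
    using wreath_map_mult[OF z z'] by (simp add: g wreath_map_one)
  then have "inv (\<phi> z') = g"
    by (intro inv_equality) (simp_all add: g)
  then have "inv g = \<phi> z'"
    by (metis inv_inv wreath_map_closed)
  then show "inv g \<in> \<phi> ` carrier wreath" using z' by blast
next
  fix x y assume "x \<in> \<phi> ` carrier wreath" "y \<in> \<phi> ` carrier wreath"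
  then show "x \<otimes> y \<in> \<phi> ` carrier wreath"
    by (auto simp: wreath_map_mult[symmetric] intro!: imageI mult_wreath_closed)
qed auto

lemma wreath_map_image: "\<phi> ` carrier wreath = generate G {s, c, h}"
proof
  have sc: "{s, c, h} \<subseteq> carrier G" by simp
  have gen: "s \<in> generate G {s, c, h}" "c \<in> generate G {s, c, h}" "h \<in> generate G {s, c, h}"
    by (auto intro: generate.incl)
  have sub: "subgroup (generate G {s, c, h}) G"
    by (rule generate_is_subgroup[OF sc])
  have m: "x \<otimes> y \<in> generate G {s, c, h}"
    if "x \<in> generate G {s, c, h}" "y \<in> generate G {s, c, h}" for x y
    using subgroup.m_closed[OF sub that] .
  have "\<phi> z \<in> generate G {s, c, h}" for z
    unfolding wreath_map_def klein_map_def bitpow_def split_beta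
    by (auto intro!: m gen generate.one)
  then show "\<phi> ` carrier wreath \<subseteq> generate G {s, c, h}" by blast
  have "\<phi> z \<in> \<phi> ` carrier wreath"
    if "z \<in> {(((1, 0), 0, 0), 0), (((0, 0), 0, 1), 0), (((0, 0), 0, 0), 1)}" for z
    using that by (auto simp: carrier_wreath)
  then have "{s, c, h} \<subseteq> \<phi> ` carrier wreath"
    by (metis (no_types, lifting) insert_iff subsetI singletonD wreath_map_generators)
  then show "generate G {s, c, h} \<subseteq> \<phi> ` carrier wreath"
    by (rule generate_subgroup_incl[OF _ subgroup_wreath_map])
qed

lemma card_generate:
  assumes "inj_on \<phi> (carrier wreath)"
  shows "card (generate G {s, c, h}) = 32"
  using card_image[OF assms] unfolding wreath_map_image
  by (simp add: carrier_wreath card_cartesian_product)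

lemma generate_iso_wreath:
  assumes "inj_on \<phi> (carrier wreath)"
  shows "G\<lparr>carrier := generate G {s, c, h}\<rparr> \<cong> wreath"
proof -
  let ?\<psi> = "inv_into (carrier wreath) \<phi>"
  have "?\<psi> (\<phi> z \<otimes> \<phi> z') = ?\<psi> (\<phi> z) \<otimes>\<^bsub>wreath\<^esub> ?\<psi> (\<phi> z')"
    if "z \<in> carrier wreath" "z' \<in> carrier wreath" for z z'
    using that assms mult_wreath_closed by (simp add: wreath_map_mult[symmetric] inv_into_f_f)
  then have "?\<psi> \<in> iso (G\<lparr>carrier := generate G {s, c, h}\<rparr>) wreath"
    unfolding iso_def hom_def wreath_map_image[symmetric]
    using assms by (auto simp: inv_into_f_f bij_betw_inv_into inj_on_imp_bij_betw)
  then show ?thesis by (auto simp: is_iso_def)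
qed

end

section \<open>The generators in simplex coordinates\<close>

text \<open>
  In the coordinates \<open>t\<^sub>k = y\<^sub>1\<cdots>y\<^sub>k\<close>, up to constant shifts, \<open>crdE n P k\<close> is the exponent of \<open>t\<^sub>k\<close> and
  \<open>crdF n P k\<close> that of \<open>1 - t\<^sub>k\<close>; the exponent of \<open>t\<^sub>k\<^sub>-\<^sub>1 - t\<^sub>k\<close> is \<open>B\<^sub>k\<close> for \<open>k \<ge> 2\<close>.
\<close>

definition crdE :: "nat \<Rightarrow> int vec \<Rightarrow> nat \<Rightarrow> int" where
  "crdE n P k = (if k = n then parA n P n else parA n P k - parA n P (k + 1) - parB n P (k + 1))"

definition crdF :: "nat \<Rightarrow> int vec \<Rightarrow> nat \<Rightarrow> int" where
  "crdF n P k = (if k = 1 then parB n P 1 else - parC n P k)"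

lemma mk_param_carrier [simp]: "mk_param n a b c \<in> carrier_vec (3 * n - 1)"
  by (simp add: mk_param_def)

lemma par_mk_param:
  "k \<in> {1..n} \<Longrightarrow> parA n (mk_param n a b c) k = a k"
  "k \<in> {1..n} \<Longrightarrow> parB n (mk_param n a b c) k = b k"
  "k \<in> {2..n} \<Longrightarrow> parC n (mk_param n a b c) k = c k"
  by (auto simp: mk_param_def parA_def parB_def parC_def le_iff_add One_nat_def)

lemma param_eqI:
  assumes "P \<in> carrier_vec (3 * n - 1)" "Q \<in> carrier_vec (3 * n - 1)"
    and A: "\<And>k. k \<in> {1..n} \<Longrightarrow> parA n P k = parA n Q k"
    and B: "\<And>k. k \<in> {1..n} \<Longrightarrow> parB n P k = parB n Q k"
    and C: "\<And>k. k \<in> {2..n} \<Longrightarrow> parC n P k = parC n Q k"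
  shows "P = Q"
proof (rule eq_vecI)
  fix i assume "i < dim_vec Q"
  then have i: "i < 3 * n - 1" using assms by simp
  consider "i < n" | "n \<le> i" "i < 2 * n" | "2 * n \<le> i" by linarith
  then show "P $ i = Q $ i"
  proof cases
    case 1 then show ?thesis using A[of "i + 1"] by (simp add: parA_def)
  next
    case 2 then show ?thesis using B[of "i - n + 1"] by (simp add: parB_def One_nat_def)
  next
    case 3 then show ?thesis using C[of "i - 2 * n + 2"] i by (auto simp: parC_def)
  qed
qed (use assms in simp)

text \<open>The exponents determine the parameter: B_1 and the C_k are read off from
  \<open>crdF\<close>, and the triangular system for \<open>crdE\<close> is solved for the A_k by
  descending induction from A_n. Identities between generators can thus be checked by their local
  rules on exponents.\<close>

lemma param_eqI_crd:
  assumes "1 \<le> n" "P \<in> carrier_vec (3 * n - 1)" "Q \<in> carrier_vec (3 * n - 1)"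
    and E: "\<And>k. k \<in> {1..n} \<Longrightarrow> crdE n P k = crdE n Q k"
    and B: "\<And>k. k \<in> {2..n} \<Longrightarrow> parB n P k = parB n Q k"
    and F: "\<And>k. k \<in> {1..n} \<Longrightarrow> crdF n P k = crdF n Q k"
  shows "P = Q"
proof (rule param_eqI)
  show "parC n P k = parC n Q k" if "k \<in> {2..n}" for k
    using F[of k] that by (simp add: crdF_def split: if_splits)
  show B': "parB n P k = parB n Q k" if "k \<in> {1..n}" for k
    using F[of k] B[of k] that by (cases "k = 1") (simp_all add: crdF_def)
  fix k assume k: "k \<in> {1..n}"
  then have "k \<le> n" by simp
  then show "parA n P k = parA n Q k" using k
  proof (induction rule: inc_induct)
    case base
    then show ?case using E[of n] by (simp add: crdE_def)
  next
    case (step m)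
    then show ?case using E[of m] B'[of "Suc m"] by (simp add: crdE_def Suc_eq_plus1)
  qed
qed (use assms in auto)

section \<open>Action of the generators on the exponents\<close>

lemma fun_carrier [simp]:
  "sigma_fun n P \<in> carrier_vec (3 * n - 1)" "chi_fun n P \<in> carrier_vec (3 * n - 1)"
  "theta_fun n P \<in> carrier_vec (3 * n - 1)"
  by (simp_all add: sigma_fun_def chi_fun_def theta_fun_def)

text \<open>\<open>chi_fun\<close> preserves A_n + B_n, so the exponent of t_{n-1} stays fixed and
  only the three exponents at the end n change.\<close>

lemma crd_chi:
  assumes "3 \<le> n"
  shows "k \<in> {1..n} \<Longrightarrow> crdE n (chi_fun n P) k = (if k = n then - crdF n P n else crdE n P k)"
    and "k \<in> {1..n} \<Longrightarrow> crdF n (chi_fun n P) k = (if k = n then - crdE n P n else crdF n P k)"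
    and "k \<in> {1..n} \<Longrightarrow> parB n (chi_fun n P) k =
      (if k = n then parB n P n + crdE n P n + crdF n P n else parB n P k)"
  using assms by (auto simp: crdE_def crdF_def chi_fun_def par_mk_param simp del: One_nat_def)

text \<open>Exchanging y_1 and y_2 replaces t_1 by t_2 / t_1 and fixes every other t_k, so only the
  exponents of t_1, t_2, 1 - t_1 and t_1 - t_2 are affected.\<close>

lemma crd_sigma:
  assumes "3 \<le> n"
  shows "k \<in> {1..n} \<Longrightarrow> crdE n (sigma_fun n P) k =
      (if k = 1 then - crdE n P 1 - parB n P 2 - crdF n P 1
       else if k = 2 then crdE n P 1 + crdE n P 2 + parB n P 2 else crdE n P k)"
    and "k \<in> {1..n} \<Longrightarrow> crdF n (sigma_fun n P) k = (if k = 1 then parB n P 2 else crdF n P k)"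
    and "k \<in> {1..n} \<Longrightarrow> parB n (sigma_fun n P) k =
      (if k = 1 then parB n P 2 else if k = 2 then crdF n P 1 else parB n P k)"
  using assms
  by (auto simp: crdE_def crdF_def sigma_fun_def par_mk_param Transposition.transpose_def
      simp del: One_nat_def)

lemma crd_theta:
  assumes "3 \<le> n"
  shows "k \<in> {1..n} \<Longrightarrow> crdE n (theta_fun n P) k = crdF n P (n + 1 - k)"
    and "k \<in> {1..n} \<Longrightarrow> crdF n (theta_fun n P) k = crdE n P (n + 1 - k)"
    and "k \<in> {2..n} \<Longrightarrow> parB n (theta_fun n P) k = parB n P (n + 2 - k)"
proof -
  assume k: "k \<in> {1..n}"
  show "crdE n (theta_fun n P) k = crdF n P (n + 1 - k)"
  proof (cases "k = n")
    case True
    then show ?thesis using assms by (simp add: crdE_def crdF_def theta_fun_def par_mk_param)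
  next
    case False
    define m where "m = n - k"
    have m: "n + 1 - k = Suc m" "n + 1 - (k + 1) = m" "n + 2 - (k + 1) = Suc m" "1 \<le> m"
      using k False by (auto simp: m_def)
    \<comment> \<open>The new A_k are differences of partial sums, so consecutive ones telescope to
      B_{m+1} - C_{m+1}; the new B_{k+1} is B_{m+1} and cancels.\<close>
    have "crdE n (theta_fun n P) k =
       (\<Sum>j=1..Suc m. parB n P j) - (\<Sum>j=2..Suc m. parC n P j)
       - ((\<Sum>j=1..m. parB n P j) - (\<Sum>j=2..m. parC n P j)) - parB n P (Suc m)"
      using k False assms m
      by (simp add: crdE_def theta_fun_def par_mk_param del: One_nat_def sum.cl_ivl_Suc)
    also have "\<dots> = - parC n P (Suc m)"
      using m by simp
    finally show ?thesis using m by (simp add: crdF_def)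
  qed
  show "crdF n (theta_fun n P) k = crdE n P (n + 1 - k)"
  proof (cases "k = 1")
    case True
    then show ?thesis using assms by (simp add: crdE_def crdF_def theta_fun_def par_mk_param)
  next
    case False
    then have "n + 1 - k + 1 = n + 2 - k" "n + 1 - k \<noteq> n" "k \<in> {2..n}"
      using k by auto
    then show ?thesis using False by (simp add: crdE_def crdF_def theta_fun_def par_mk_param)
  qed
next
  assume "k \<in> {2..n}"
  then show "parB n (theta_fun n P) k = parB n P (n + 2 - k)"
    by (auto simp: theta_fun_def par_mk_param)
qed

text \<open>Reversal of \<open>{j..n}\<close>: \<open>j = 1\<close> for the factors t_k and 1 - t_k,
  \<open>j = 2\<close> for the differences t_{k-1} - t_k. Naming it keeps truncated subtraction out
  of the simplifier, which then conjugates by \<open>theta_fun\<close> using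
  \<open>mirror_simps\<close>.\<close>

definition mirror :: "nat \<Rightarrow> nat \<Rightarrow> nat \<Rightarrow> nat" where
  "mirror n j k = n + j - k"

lemma mirror_simps:
  assumes "3 \<le> n"
  shows "k \<in> {1..n} \<Longrightarrow> mirror n 1 k \<in> {1..n}" "k \<in> {1..n} \<Longrightarrow> mirror n 1 (mirror n 1 k) = k"
    "k \<in> {2..n} \<Longrightarrow> mirror n 2 k \<in> {2..n}" "k \<in> {2..n} \<Longrightarrow> mirror n 2 (mirror n 2 k) = k"
    "k \<in> {1..n} \<Longrightarrow> mirror n 1 k = 1 \<longleftrightarrow> k = n" "k \<in> {1..n} \<Longrightarrow> mirror n 1 k = n \<longleftrightarrow> k = 1"
    "k \<in> {1..n} \<Longrightarrow> mirror n 1 k = 2 \<longleftrightarrow> k = n - 1"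
    "k \<in> {2..n} \<Longrightarrow> mirror n 2 k \<in> {1..n}" "k \<in> {2..n} \<Longrightarrow> mirror n 2 k \<noteq> 1"
    "k \<in> {2..n} \<Longrightarrow> mirror n 2 k = 2 \<longleftrightarrow> k = n" "k \<in> {2..n} \<Longrightarrow> mirror n 2 k = n \<longleftrightarrow> k = 2"
    "mirror n 1 1 = n" "mirror n 1 2 = n - 1" "mirror n 1 n = 1"
    "mirror n 2 2 = n" "mirror n 2 n = 2"
    "1 \<in> {1..n}" "2 \<in> {1..n}" "n \<in> {1..n}" "2 \<in> {2..n}" "n \<in> {2..n}" "n - 1 \<in> {1..n}" "1 \<noteq> n" "n \<noteq> 1"
  using assms unfolding mirror_def by auto

lemmas crd_conj_simps =
  crd_chi crd_sigma crd_theta[folded mirror_def] mirror_simps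

text \<open>The rule \<open>crd_chi\<close> seen in the mirror. The difference next to the end is
  now t_1 - t_2, which has index 2.\<close>

lemma crd_conj_chi:
  fixes P :: "int vec"
  assumes "3 \<le> n"
  defines "R \<equiv> theta_fun n (chi_fun n (theta_fun n P))"
  shows "k \<in> {1..n} \<Longrightarrow> crdE n R k = (if k = 1 then - crdF n P 1 else crdE n P k)"
    and "k \<in> {1..n} \<Longrightarrow> crdF n R k = (if k = 1 then - crdE n P 1 else crdF n P k)"
    and "k \<in> {2..n} \<Longrightarrow> parB n R k =
      (if k = 2 then parB n P 2 + crdE n P 1 + crdF n P 1 else parB n P k)"
  using assms(1) unfolding R_def
  by (simp_all add: crd_conj_simps del: atLeastAtMost_iff)

lemma crd_conj_sigma:
  fixes P :: "int vec"
  assumes "3 \<le> n"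
  defines "R \<equiv> theta_fun n (sigma_fun n (theta_fun n P))"
  shows "k \<in> {1..n} \<Longrightarrow> crdE n R k = (if k = n then parB n P n else crdE n P k)"
    and "k \<in> {1..n} \<Longrightarrow> crdF n R k =
      (if k = n then - crdF n P n - parB n P n - crdE n P n
       else if k = n - 1 then crdF n P n + crdF n P (n - 1) + parB n P n else crdF n P k)"
    and "k \<in> {2..n} \<Longrightarrow> parB n R k = (if k = n then crdE n P n else parB n P k)"
  using assms(1) unfolding R_def
  by (simp_all add: crd_conj_simps del: atLeastAtMost_iff)

lemmas crd_simps = crd_chi crd_sigma crd_conj_chi crd_conj_sigma

section \<open>Relations between the generators\<close>

lemma sigma_sigma:
  assumes "3 \<le> n" "P \<in> carrier_vec (3 * n - 1)"
  shows "sigma_fun n (sigma_fun n P) = P"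
  by (rule param_eqI_crd[of n]) (use assms in \<open>auto simp: crd_simps\<close>)

lemma chi_chi:
  assumes "3 \<le> n" "P \<in> carrier_vec (3 * n - 1)"
  shows "chi_fun n (chi_fun n P) = P"
  by (rule param_eqI_crd[of n]) (use assms in \<open>auto simp: crd_simps\<close>)

lemma theta_theta:
  assumes "3 \<le> n" "P \<in> carrier_vec (3 * n - 1)"
  shows "theta_fun n (theta_fun n P) = P"
  by (rule param_eqI_crd[of n])
    (use assms in \<open>simp_all add: crd_conj_simps del: atLeastAtMost_iff\<close>)

text \<open>For \<open>3 \<le> n\<close> the two maps read and change disjoint sets of exponents, at
  opposite ends. The same disjointness gives \<open>sigma_conj_sigma\<close> and
  \<open>chi_conj_chi\<close>.\<close>

lemma sigma_chi:
  assumes "3 \<le> n"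
  shows "sigma_fun n (chi_fun n P) = chi_fun n (sigma_fun n P)"
  by (rule param_eqI_crd[of n]) (use assms in \<open>auto simp: crd_simps\<close>)

lemma sigma_conj_sigma:
  assumes "3 \<le> n"
  shows "sigma_fun n (theta_fun n (sigma_fun n (theta_fun n P))) =
    theta_fun n (sigma_fun n (theta_fun n (sigma_fun n P)))"
  by (rule param_eqI_crd[of n]) (use assms in \<open>auto simp: crd_simps\<close>)

text \<open>Both maps act at the same end, so this relation is a calculation: with E, F, B the
  exponents of t_1, 1 - t_1, t_1 - t_2, either composite sends (E, F, B) to (-B, E + F + B, -E) and
  adds E + B to the exponent of t_2.\<close>

lemma sigma_conj_chi:
  assumes "3 \<le> n"
  shows "sigma_fun n (theta_fun n (chi_fun n (theta_fun n P))) =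
    theta_fun n (chi_fun n (theta_fun n (sigma_fun n P)))"
  by (rule param_eqI_crd[of n]) (use assms in \<open>auto simp: crd_simps\<close>)

lemma chi_conj_chi:
  assumes "3 \<le> n"
  shows "chi_fun n (theta_fun n (chi_fun n (theta_fun n P))) =
    theta_fun n (chi_fun n (theta_fun n (chi_fun n P)))"
  by (rule param_eqI_crd[of n]) (use assms in \<open>auto simp: crd_simps\<close>)

section \<open>The matrix group\<close>

lemma mat_eqI_mult_vec:
  fixes M N :: "'a::comm_ring_1 mat"
  assumes "M \<in> carrier_mat s s" "N \<in> carrier_mat s s"
    and eq: "\<And>v. v \<in> carrier_vec s \<Longrightarrow> M *\<^sub>v v = N *\<^sub>v v"
  shows "M = N"
proof (rule eq_matI)
  fix i j assume ij: "i < dim_row N" "j < dim_col N"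
  have "(M *\<^sub>v unit_vec s j) $ i = (N *\<^sub>v unit_vec s j) $ i"
    by (simp add: eq)
  then show "M $$ (i, j) = N $$ (i, j)"
    using assms(1,2) ij by (simp add: scalar_prod_right_unit[of _ s])
qed (use assms in auto)

lemma GL_simps:
  "x \<otimes>\<^bsub>GL s\<^esub> y = x * y" "\<one>\<^bsub>GL s\<^esub> = 1\<^sub>m s" "carrier (GL s) \<subseteq> carrier_mat s s"
  by (auto simp: GL_def units_of_def ring_mat_simps Units_def)

lemma group_GL: "group (GL s)"
proof -
  interpret R: ring "ring_mat TYPE(int) s ()" by (rule ring_mat)
  show ?thesis unfolding GL_def by (rule R.units_group)
qed

lemma involution_in_GL:
  assumes "M \<in> carrier_mat s s" "M * M = 1\<^sub>m s"
  shows "M \<in> carrier (GL s)"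
  using assms unfolding GL_def units_of_carrier by (auto simp: Units_def ring_mat_simps)

lemma GL_mult_vec:
  assumes "x \<in> carrier (GL s)" "y \<in> carrier (GL s)" "P \<in> carrier_vec s"
  shows "(x \<otimes>\<^bsub>GL s\<^esub> y) *\<^sub>v P = x *\<^sub>v (y *\<^sub>v P)"
  using assms GL_simps(3)[of s] by (auto simp: GL_simps(1) intro!: assoc_mult_mat_vec)

lemma bitpow_GL_mult_vec:
  assumes "P \<in> carrier_vec s"
  shows "bitpow (GL s) x i *\<^sub>v P = (if i = 0 then P else x *\<^sub>v P)"
  using assms by (simp add: bitpow_def GL_simps)

lemma generator_mats_carrier [simp]:
  "sigma_mat n \<in> carrier_mat (3 * n - 1) (3 * n - 1)"
  "chi_mat n \<in> carrier_mat (3 * n - 1) (3 * n - 1)"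
  "theta_mat n \<in> carrier_mat (3 * n - 1) (3 * n - 1)"
  by (simp_all add: sigma_mat_def chi_mat_def theta_mat_def mat_of_fun_def)

lemma generators_mult_vec:
  assumes "3 \<le> n" "P \<in> carrier_vec (3 * n - 1)"
  shows "sigma_mat n *\<^sub>v P = sigma_fun n P" "chi_mat n *\<^sub>v P = chi_fun n P"
    "theta_mat n *\<^sub>v P = theta_fun n P"
  using assms sigma_mat_mult_vec chi_mat_mult_vec theta_mat_mult_vec by simp_all

lemma generators_involutions:
  assumes "3 \<le> n"
  shows "sigma_mat n * sigma_mat n = 1\<^sub>m (3 * n - 1)" "chi_mat n * chi_mat n = 1\<^sub>m (3 * n - 1)"
    "theta_mat n * theta_mat n = 1\<^sub>m (3 * n - 1)"
  by (rule mat_eqI_mult_vec[of _ "3 * n - 1"];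
      use assms in \<open>simp add: assoc_mult_mat_vec[of _ "3 * n - 1" "3 * n - 1" _ "3 * n - 1"] generators_mult_vec sigma_sigma chi_chi theta_theta
        mult_carrier_mat[of _ "3 * n - 1" "3 * n - 1"]\<close>)+

lemma generators_in_GL:
  assumes "3 \<le> n"
  shows "sigma_mat n \<in> carrier (GL (3 * n - 1))" "chi_mat n \<in> carrier (GL (3 * n - 1))"
    "theta_mat n \<in> carrier (GL (3 * n - 1))"
  using assms by (simp_all add: involution_in_GL generators_involutions)

lemma klein_wreath_generators_GL:
  assumes "3 \<le> n"
  shows "klein_wreath_generators (GL (3 * n - 1)) (sigma_mat n) (chi_mat n) (theta_mat n)"
proof -
  interpret group "GL (3 * n - 1)" by (rule group_GL)
  note in_GL = generators_in_GL[OF assms]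
  have eqI: "x = y" if "x \<in> carrier (GL (3 * n - 1))" "y \<in> carrier (GL (3 * n - 1))"
    "\<And>P. P \<in> carrier_vec (3 * n - 1) \<Longrightarrow> x *\<^sub>v P = y *\<^sub>v P" for x y
    using mat_eqI_mult_vec[of x "3 * n - 1" y] that GL_simps(3) by blast
  show ?thesis
  proof unfold_locales
    show "sigma_mat n \<otimes>\<^bsub>GL (3 * n - 1)\<^esub> sigma_mat n = \<one>\<^bsub>GL (3 * n - 1)\<^esub>"
      "chi_mat n \<otimes>\<^bsub>GL (3 * n - 1)\<^esub> chi_mat n = \<one>\<^bsub>GL (3 * n - 1)\<^esub>"
      "theta_mat n \<otimes>\<^bsub>GL (3 * n - 1)\<^esub> theta_mat n = \<one>\<^bsub>GL (3 * n - 1)\<^esub>"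
      by (simp_all only: GL_simps generators_involutions[OF assms])
  qed (use assms in_GL in \<open>auto intro!: eqI simp: GL_mult_vec generators_mult_vec sigma_chi
      sigma_conj_sigma sigma_conj_chi chi_conj_chi\<close>)
qed

definition apply_bit :: "int \<Rightarrow> ('a \<Rightarrow> 'a) \<Rightarrow> 'a \<Rightarrow> 'a" where
  "apply_bit i f x = (if i = 0 then x else f x)"

text \<open>The value of \<open>wreath_map\<close> at an element with last bit 0, as a map on
  parameters.\<close>

definition wreath_act :: "nat \<Rightarrow> int \<Rightarrow> int \<Rightarrow> int \<Rightarrow> int \<Rightarrow> int vec \<Rightarrow> int vec" where
  "wreath_act n a b u v P =
    apply_bit a (sigma_fun n) (apply_bit b (\<lambda>Q. theta_fun n (chi_fun n (theta_fun n Q)))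
      (apply_bit u (\<lambda>Q. theta_fun n (sigma_fun n (theta_fun n Q))) (apply_bit v (chi_fun n) P)))"

lemma apply_bit_carrier [simp]:
  "P \<in> carrier_vec s \<Longrightarrow> f P \<in> carrier_vec s \<Longrightarrow> apply_bit i f P \<in> carrier_vec s"
  by (simp add: apply_bit_def)

lemma wreath_map_mult_vec:
  assumes n: "3 \<le> n" and P: "P \<in> carrier_vec (3 * n - 1)"
  shows "group.wreath_map (GL (3 * n - 1)) (sigma_mat n) (chi_mat n) (theta_mat n)
      (((a, b), u, v), e) *\<^sub>v P =
    wreath_act n a b u v (if e = 0 then P else theta_fun n P)"
proof -
  interpret klein_wreath_generators "GL (3 * n - 1)" "sigma_mat n" "chi_mat n" "theta_mat n"
    by (rule klein_wreath_generators_GL[OF n])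
  have bitpow: "bitpow (GL (3 * n - 1)) x i *\<^sub>v Q = apply_bit i ((*\<^sub>v) x) Q"
    if "Q \<in> carrier_vec (3 * n - 1)" for x i Q
    using that by (simp add: bitpow_GL_mult_vec apply_bit_def)
  have ext: "apply_bit i f Q = apply_bit i g Q" if "f Q = g Q" for i and f g :: "int vec \<Rightarrow> int vec" and Q
    using that by (simp add: apply_bit_def)
  have gens: "apply_bit i ((*\<^sub>v) (sigma_mat n)) Q = apply_bit i (sigma_fun n) Q"
    "apply_bit i ((*\<^sub>v) (chi_mat n)) Q = apply_bit i (chi_fun n) Q"
    "apply_bit i ((*\<^sub>v) (theta_mat n)) Q = apply_bit i (theta_fun n) Q"
    "apply_bit i ((*\<^sub>v) r) Q = apply_bit i (\<lambda>Q. theta_fun n (sigma_fun n (theta_fun n Q))) Q"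
    "apply_bit i ((*\<^sub>v) t) Q = apply_bit i (\<lambda>Q. theta_fun n (chi_fun n (theta_fun n Q))) Q"
    if "Q \<in> carrier_vec (3 * n - 1)" for i Q
    using n that by (auto intro!: ext simp: GL_mult_vec generators_mult_vec)
  show ?thesis
    unfolding wreath_map_def klein_map_def wreath_act_def case_prod_conv using P
    by (simp add: GL_mult_vec bitpow gens generators_mult_vec[OF n] apply_bit_def[of e])
qed

section \<open>Separation of the group elements by two exponents\<close>

lemma crd_chi_ends:
  assumes "3 \<le> n"
  shows "crdE n (chi_fun n P) n = - crdF n P n" "crdF n (chi_fun n P) n = - crdE n P n"
    "parB n (chi_fun n P) n = parB n P n + crdE n P n + crdF n P n"
    "crdE n (chi_fun n P) 1 = crdE n P 1" "crdF n (chi_fun n P) 1 = crdF n P 1"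
    "parB n (chi_fun n P) 2 = parB n P 2"
  using assms by (simp_all add: crd_chi)

lemma crd_conj_sigma_ends:
  assumes "3 \<le> n"
  defines "R \<equiv> \<lambda>P. theta_fun n (sigma_fun n (theta_fun n P))"
  shows "crdE n (R P) n = parB n P n"
    "crdE n (R P) 1 = crdE n P 1" "crdF n (R P) 1 = crdF n P 1" "parB n (R P) 2 = parB n P 2"
  using assms(1) unfolding R_def by (simp_all add: crd_conj_sigma)

lemma crd_conj_chi_ends:
  assumes "3 \<le> n"
  defines "R \<equiv> \<lambda>P. theta_fun n (chi_fun n (theta_fun n P))"
  shows "crdE n (R P) n = crdE n P n" "parB n (R P) n = parB n P n"
    "crdF n (R P) 1 = - crdE n P 1" "parB n (R P) 2 = parB n P 2 + crdE n P 1 + crdF n P 1"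
  using assms(1) unfolding R_def by (simp_all add: crd_conj_chi)

lemma crd_sigma_ends:
  assumes "3 \<le> n"
  shows "crdE n (sigma_fun n P) n = crdE n P n" "crdF n (sigma_fun n P) 1 = parB n P 2"
  using assms by (simp_all add: crd_sigma)

text \<open>A_n is moved only by the Klein group at the end n, B_1 only by the one at the end 1, and
  each runs through four different linear forms. The two numbers therefore reveal all four bits at a
  suitable parameter.\<close>

lemma wreath_act_crd:
  assumes "3 \<le> n"
  shows "crdE n (wreath_act n a b u v P) n =
      (if u = 0 then if v = 0 then crdE n P n else - crdF n P n
       else if v = 0 then parB n P n else parB n P n + crdE n P n + crdF n P n)"
    and "crdF n (wreath_act n a b u v P) 1 =
      (if a = 0 then if b = 0 then crdF n P 1 else - crdE n P 1
       else if b = 0 then parB n P 2 else parB n P 2 + crdE n P 1 + crdF n P 1)"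
  using assms
  by (simp_all add: wreath_act_def apply_bit_def crd_chi_ends crd_conj_sigma_ends crd_conj_chi_ends
      crd_sigma_ends)

lemma crd_theta_ends:
  assumes "3 \<le> n"
  shows "crdE n (theta_fun n P) n = crdF n P 1" "crdF n (theta_fun n P) n = crdE n P 1"
    "parB n (theta_fun n P) n = parB n P 2" "crdE n (theta_fun n P) 1 = crdF n P n"
    "crdF n (theta_fun n P) 1 = crdE n P n" "parB n (theta_fun n P) 2 = parB n P n"
  using assms by (simp_all add: crd_theta)

lemma wreath_map_inj:
  assumes n: "3 \<le> n"
  shows "inj_on (group.wreath_map (GL (3 * n - 1)) (sigma_mat n) (chi_mat n) (theta_mat n))
    (carrier wreath)"
proof -
  \<comment> \<open>\<open>P\<close> makes the orbits of \<open>A\<^sub>n\<close> under one Klein group, \<open>{1, 2, 4, -1}\<close>, and of \<open>B\<^sub>1\<close> under the other,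
    \<open>{10, 20, 40, -10}\<close>, disjoint and of size four; \<open>\<theta>\<close> exchanges them.\<close>
  define P where "P = mk_param n (\<lambda>k. if k = 1 then -20 else if k = n then 1 else 0)
    (\<lambda>k. if k = 1 then 10 else if k = 2 then 20 else if k = n then 2 else 0) (\<lambda>k. 4)"
  have P: "P \<in> carrier_vec (3 * n - 1)" by (simp add: P_def)
  have crdP: "crdE n P n = 1" "crdF n P n = -4" "parB n P n = 2"
    "crdE n P 1 = -40" "crdF n P 1 = 10" "parB n P 2 = 20"
    using n by (auto simp: P_def crdE_def crdF_def par_mk_param)
  define dec_end where "dec_end q = (if q = (1::int) then (0::int, 0::int)
    else if q = 2 then (1, 0) else if q = 4 then (0, 1) else (1, 1))" for q
  define dec_start where "dec_start q = (if q = (10::int) then (0::int, 0::int)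
    else if q = 20 then (1, 0) else if q = 40 then (0, 1) else (1, 1))" for q
  \<comment> \<open>The decoder reads the last bit from the size of \<open>q\<close>: B_1 stays in
    the orbit of large numbers unless \<open>theta_fun\<close> has exchanged the two orbits, in
    which case each value is decoded by the other table.\<close>
  define dec where "dec M = (let p = crdE n (M *\<^sub>v P) n; q = crdF n (M *\<^sub>v P) 1 in
    if \<bar>q\<bar> \<ge> 10 then ((dec_start q, dec_end p), 0) else ((dec_end q, dec_start p), 1::int))" for M
  show ?thesis
  proof (rule inj_on_inverseI)
    fix z assume "z \<in> carrier wreath"
    then obtain a b u v e where z: "z = (((a, b), u, v), e)"
      and bits: "a \<in> {0,1}" "b \<in> {0,1}" "u \<in> {0,1}" "v \<in> {0,1}" "e \<in> {0,1}"
      unfolding carrier_wreath by blast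
    show "dec (group.wreath_map (GL (3 * n - 1)) (sigma_mat n) (chi_mat n) (theta_mat n) z) = z"
      unfolding dec_def z wreath_map_mult_vec[OF n P]
      using bits
      by (auto simp: wreath_act_crd[OF n] crdP crd_theta_ends[OF n] dec_end_def dec_start_def Let_def)
  qed
qed

section \<open>Rationality of the quotients\<close>

lemma rv_quotient_eq:
  assumes "x = ennreal q * y" "0 < y" "y \<noteq> \<infinity>" "0 \<le> q"
  shows "rv_quotient x y = ennreal q"
  using assms by (simp add: rv_quotient_def mult_divide_eq_ennreal)

lemma wreath_act_ratio:
  assumes n: "3 \<le> n" and P: "P \<in> carrier_vec (3 * n - 1)"
    and sigma: "\<And>P. P \<in> carrier_vec (3 * n - 1) \<Longrightarrow> I (sigma_fun n P) = I P"
    and theta: "\<And>P. P \<in> carrier_vec (3 * n - 1) \<Longrightarrow> I (theta_fun n P) = I P"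
    and conv: "\<And>P. P \<in> carrier_vec (3 * n - 1) \<Longrightarrow> I P \<noteq> \<infinity> \<Longrightarrow> 0 \<le> parA n P n \<and> 0 \<le> parB n P n"
    and chi: "\<And>P. P \<in> carrier_vec (3 * n - 1) \<Longrightarrow> I P \<noteq> \<infinity> \<Longrightarrow>
       0 \<le> parC n P n \<Longrightarrow> parC n P n \<le> parA n P n + parB n P n \<Longrightarrow>
       \<exists>q::rat. 0 < q \<and> I (chi_fun n P) = ennreal (of_rat q) * I P"
    and fin: "I P \<noteq> \<infinity>" "I (wreath_act n a b u v P) \<noteq> \<infinity>"
  shows "\<exists>q::rat. 0 < q \<and> I (wreath_act n a b u v P) = ennreal (of_rat q) * I P"
proof -
  let ?chi' = "\<lambda>P. theta_fun n (chi_fun n (theta_fun n P))"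
  \<comment> \<open>The conditions on C_n in \<open>chi\<close> say that A_n and B_n are nonnegative
    at the target, since these are C_n and A_n + B_n - C_n at the source. This is the form in which
    \<open>conv\<close> supplies them.\<close>
  have chi_or: "\<exists>q::rat. 0 < q \<and> I (chi_fun n Q) = ennreal (of_rat q) * I Q"
    if "Q \<in> carrier_vec (3 * n - 1)" "I Q \<noteq> \<infinity>" "0 \<le> parA n (chi_fun n Q) n" "0 \<le> parB n (chi_fun n Q) n" for Q
    using chi[of Q] that n by (simp add: chi_fun_def par_mk_param)
  have chi_fin: "\<exists>q::rat. 0 < q \<and> I (chi_fun n Q) = ennreal (of_rat q) * I Q"
    if "Q \<in> carrier_vec (3 * n - 1)" "I Q \<noteq> \<infinity>" "I (chi_fun n Q) \<noteq> \<infinity>" for Q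
    using chi_or[of Q] conv[of "chi_fun n Q"] that by simp
  define Q where "Q = (if v = 0 then P else chi_fun n P)"
  define R where "R = (if b = 0 then Q else ?chi' Q)"
  have car: "Q \<in> carrier_vec (3 * n - 1)" "R \<in> carrier_vec (3 * n - 1)"
    using P by (simp_all add: Q_def R_def)
  \<comment> \<open>An outer \<open>sigma_fun\<close> or \<open>theta_fun\<close> does not change
    \<open>I\<close>. The conjugate of \<open>sigma_fun\<close> stands inside \<open>?chi'\<close>;
    there two adjacent \<open>theta_fun\<close> cancel and \<open>sigma_fun\<close> moves outward
    past \<open>chi_fun\<close>.\<close>
  have "I (wreath_act n a b u v P) = I R"
    using car P n by (simp add: wreath_act_def apply_bit_def Q_def[symmetric] R_def sigma theta theta_theta sigma_chi[symmetric])
  moreover have "\<exists>q::rat. 0 < q \<and> I R = ennreal (of_rat q) * I P"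
  proof -
    have finR: "I R \<noteq> \<infinity>" using fin(2) calculation by simp
    have Q: "\<exists>q::rat. 0 < q \<and> I Q = ennreal (of_rat q) * I P"
    proof (cases "v = 0")
      case True
      then show ?thesis by (intro exI[of _ 1]) (simp add: Q_def)
    next
      case False
      \<comment> \<open>\<open>Q\<close> might a priori diverge, so \<open>conv\<close> cannot be
        applied to it. It applies to \<open>R\<close>, and \<open>?chi'\<close> changes neither A_n
        nor B_n.\<close>
      have "parA n R n = parA n Q n" "parB n R n = parB n Q n"
        using n crd_conj_chi(1,3)[of n n Q] by (auto simp: R_def crdE_def)
      then have "0 \<le> parA n Q n" "0 \<le> parB n Q n"
        using conv[OF car(2) finR] by simp_all
      then show ?thesis using chi_or[OF P fin(1)] False by (simp add: Q_def)
    qed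
    then obtain q :: rat where q: "0 < q" "I Q = ennreal (of_rat q) * I P" by blast
    then have finQ: "I Q \<noteq> \<infinity>" using fin(1) by (simp add: ennreal_mult_eq_top_iff)
    have "\<exists>q::rat. 0 < q \<and> I R = ennreal (of_rat q) * I Q"
    proof (cases "b = 0")
      case True
      then show ?thesis by (intro exI[of _ 1]) (simp add: R_def)
    next
      case False
      then show ?thesis
        using chi_fin[of "theta_fun n Q"] finQ finR car by (simp add: R_def theta)
    qed
    then obtain q' :: rat where "0 < q'" "I R = ennreal (of_rat q') * I Q" by blast
    then show ?thesis
      by (intro exI[of _ "q' * q"]) (use q in \<open>simp add: of_rat_mult ennreal_mult mult.assoc\<close>)
  qed
  ultimately show ?thesis by simp
qed

text \<open>Stated for an arbitrary family \<open>I\<close>, this isolates what the analysis has to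
  provide: positivity, two invariances, a necessary condition for convergence, and the ratio under
  \<open>chi_fun\<close>.\<close>

lemma rhin_viola_group_generate:
  assumes n: "3 \<le> n"
    and pos: "\<And>P. P \<in> carrier_vec (3 * n - 1) \<Longrightarrow> 0 < I P"
    and sigma: "\<And>P. P \<in> carrier_vec (3 * n - 1) \<Longrightarrow> I (sigma_fun n P) = I P"
    and theta: "\<And>P. P \<in> carrier_vec (3 * n - 1) \<Longrightarrow> I (theta_fun n P) = I P"
    and conv: "\<And>P. P \<in> carrier_vec (3 * n - 1) \<Longrightarrow> I P \<noteq> \<infinity> \<Longrightarrow> 0 \<le> parA n P n \<and> 0 \<le> parB n P n"
    and chi: "\<And>P. P \<in> carrier_vec (3 * n - 1) \<Longrightarrow> I P \<noteq> \<infinity> \<Longrightarrow>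
       0 \<le> parC n P n \<Longrightarrow> parC n P n \<le> parA n P n + parB n P n \<Longrightarrow>
       \<exists>q::rat. 0 < q \<and> I (chi_fun n P) = ennreal (of_rat q) * I P"
  shows "rhin_viola_group (3 * n - 1) I
    (generate (GL (3 * n - 1)) {sigma_mat n, chi_mat n, theta_mat n})"
proof -
  interpret klein_wreath_generators "GL (3 * n - 1)" "sigma_mat n" "chi_mat n" "theta_mat n"
    by (rule klein_wreath_generators_GL[OF n])
  have "\<exists>q::rat. 0 < q \<and> rv_quotient (I (g *\<^sub>v P)) (I P) = ennreal (of_rat q)"
    if g: "g \<in> generate (GL (3 * n - 1)) {sigma_mat n, chi_mat n, theta_mat n}"
      and P: "P \<in> carrier_vec (3 * n - 1)" and iff: "I (g *\<^sub>v P) = \<infinity> \<longleftrightarrow> I P = \<infinity>" for g P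
  proof (cases "I P = \<infinity>")
    case True
    then show ?thesis using iff by (intro exI[of _ 1]) (simp add: rv_quotient_def)
  next
    case False
    obtain a b u v e where "g = wreath_map (sigma_mat n) (chi_mat n) (theta_mat n) (((a, b), u, v), e)"
      using g unfolding wreath_map_image[symmetric] by auto
    then have gP: "g *\<^sub>v P = wreath_act n a b u v (if e = 0 then P else theta_fun n P)"
      using wreath_map_mult_vec[OF n P] by simp
    let ?Q = "if e = 0 then P else theta_fun n P"
    have Q: "?Q \<in> carrier_vec (3 * n - 1)" "I ?Q = I P"
      using P theta by auto
    have fin: "I ?Q \<noteq> \<infinity>" "I (wreath_act n a b u v ?Q) \<noteq> \<infinity>"
      using False iff by (simp_all only: Q(2) gP[symmetric] simp_thms)
    obtain q :: rat where "0 < q" "I (g *\<^sub>v P) = ennreal (of_rat q) * I P"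
      using wreath_act_ratio[OF n Q(1) sigma theta conv chi fin] unfolding gP Q(2) by blast
    then show ?thesis
      using False pos[OF P] by (intro exI[of _ q]) (simp add: rv_quotient_eq)
  qed
  then show ?thesis
    unfolding rhin_viola_group_def
    using pos generate_is_subgroup[of "{sigma_mat n, chi_mat n, theta_mat n}"] by auto
qed

section \<open>Convergence and the hypergeometric transformation\<close>

interpretation lborel_family: product_sigma_finite "\<lambda>_. lborel :: real measure"
  by (simp add: product_sigma_finite_def lborel.sigma_finite_measure_axioms)

section \<open>Measure and positivity on the cube\<close>

lemma space_lebesgue_n: "space (lebesgue_n n) = PiE {1..n} (\<lambda>_. UNIV)"
  by (simp add: lebesgue_n_def space_PiM)

lemma measurable_coordinate_lebesgue_n [measurable (raw)]:
  "k \<in> {1..n} \<Longrightarrow> (\<lambda>y. y k) \<in> borel_measurable (lebesgue_n n)"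
  unfolding lebesgue_n_def by measurable

lemma measurable_lebesgue_nI:
  assumes "\<And>k. k \<in> {1..n} \<Longrightarrow> (\<lambda>x. f x k) \<in> borel_measurable M"
  shows "(\<lambda>x. \<lambda>k\<in>{1..n}. f x k) \<in> measurable M (lebesgue_n n)"
  unfolding lebesgue_n_def using assms by (intro measurable_restrict) simp

lemma K_integrand_measurable [measurable]: "K_integrand n P \<in> borel_measurable (lebesgue_n n)"
  unfolding K_integrand_def
  by (intro borel_measurable_divide borel_measurable_prod borel_measurable_times powi_borel_measurable
      borel_measurable_diff measurable_coordinate_lebesgue_n) auto

text \<open>Coordinates outside \<open>I\<close> are unconstrained, so that membership of an updated
  point splits into a condition on the old coordinates and one on the new value.\<close>

definition open_cube :: "nat set \<Rightarrow> (nat \<Rightarrow> real) set" where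
  "open_cube I = {y. \<forall>k\<in>I. 0 < y k \<and> y k < 1}"

text \<open>Both cubes have measure one, so they differ by a null set. Hence the default values of
  the integrand on the boundary do not influence \<open>K\<close>.\<close>

lemma AE_cube:
  assumes "finite I"
  shows "AE y in PiM I (\<lambda>_. lborel). indicator (PiE I (\<lambda>_. {0..1})) y = (indicator (open_cube I) y :: ennreal)"
proof -
  let ?M = "PiM I (\<lambda>_. lborel :: real measure)"
  let ?C = "PiE I (\<lambda>_. {0..1::real})" and ?O = "PiE I (\<lambda>_. {0<..<1::real})"
  have sets: "?C \<in> sets ?M" "?O \<in> sets ?M"
    using assms by (auto intro!: sets_PiM_I_finite)
  have "emeasure ?M ?C = 1" "emeasure ?M ?O = 1"
    using assms by (subst lborel_family.emeasure_PiM; auto)+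
  moreover have "?O \<subseteq> ?C" by (intro PiE_mono) auto
  ultimately have "emeasure ?M (?C - ?O) = 0"
    using sets by (subst emeasure_Diff) auto
  then have "?C - ?O \<in> null_sets ?M" using sets by auto
  then have "AE y in ?M. y \<notin> ?C - ?O" by (rule AE_not_in)
  then show ?thesis
    using AE_space
  proof eventually_elim
    case (elim y)
    then have "y \<in> ?O \<longleftrightarrow> y \<in> open_cube I"
      by (auto simp: open_cube_def PiE_iff space_PiM)
    then show ?case using elim \<open>?O \<subseteq> ?C\<close> by (auto simp: indicator_def)
  qed
qed

lemma AE_unit_cube:
  "AE y in lebesgue_n n. indicator (unit_cube n) y = (indicator (open_cube {1..n}) y :: ennreal)"
  unfolding lebesgue_n_def unit_cube_def by (rule AE_cube) simp

lemma emeasure_open_cube: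
  assumes "finite I"
  shows "emeasure (PiM I (\<lambda>_. lborel)) (PiE I (\<lambda>_. {0<..<1::real})) = 1"
  using assms by (subst lborel_family.emeasure_PiM) auto

lemma pred_open_cube [measurable]:
  assumes "finite I" "I \<subseteq> {1..n}"
  shows "indicator (open_cube I) \<in> borel_measurable (lebesgue_n n)"
proof -
  have "Measurable.pred (lebesgue_n n) (\<lambda>y. \<forall>k\<in>I. 0 < y k \<and> y k < 1)"
    using assms by (intro pred_intros_finite pred_intros_logic) (auto intro!: borel_measurable_less)
  then show ?thesis
    unfolding open_cube_def by (intro borel_measurable_indicator') auto
qed

lemma prod_in_unit:
  assumes "finite I" "I \<noteq> {}" "\<And>j. j \<in> I \<Longrightarrow> 0 < y j \<and> y j < (1::real)"
  shows "0 < prod y I" "prod y I < 1"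
proof -
  show "0 < prod y I" using assms by (intro prod_pos) auto
  obtain i where "i \<in> I" using assms by blast
  then have "prod y I < (\<Prod>j\<in>I. 1)"
    using assms by (intro prod_mono_strict[of i]) (auto simp: less_imp_le)
  then show "prod y I < 1" by simp
qed

lemma K_integrand_pos:
  assumes "y \<in> open_cube {1..n}"
  shows "0 < K_integrand n P y"
proof -
  have "(\<Prod>j=1..k. y j) < 1" if "k \<in> {2..n}" for k
    using assms that by (intro prod_in_unit) (auto simp: open_cube_def)
  then show ?thesis
    using assms unfolding K_integrand_def
    by (intro divide_pos_pos prod_pos) (auto simp: open_cube_def intro!: mult_pos_pos zero_less_power_int)
qed

lemma K_eq_open:
  "K n P = (\<integral>\<^sup>+y. indicator (open_cube {1..n}) y * ennreal (K_integrand n P y) \<partial>lebesgue_n n)"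
  unfolding K_def
  using AE_unit_cube[of n] by (intro nn_integral_cong_AE) (auto simp: mult.commute)

lemma K_pos: "0 < K n P"
proof -
  have "\<not> (AE y in lebesgue_n n. indicator (open_cube {1..n}) y * ennreal (K_integrand n P y) = 0)"
  proof
    assume "AE y in lebesgue_n n. indicator (open_cube {1..n}) y * ennreal (K_integrand n P y) = 0"
    then have "AE y in lebesgue_n n. y \<notin> PiE {1..n} (\<lambda>_. {0<..<1})"
    proof eventually_elim
      case (elim y)
      then show ?case
        using K_integrand_pos[of y n P] by (auto simp: indicator_def open_cube_def PiE_iff split: if_splits)
    qed
    moreover have "PiE {1..n} (\<lambda>_. {0<..<1}) \<in> sets (lebesgue_n n)"
      unfolding lebesgue_n_def by (auto intro!: sets_PiM_I_finite)
    ultimately have "emeasure (lebesgue_n n) (PiE {1..n} (\<lambda>_. {0<..<1})) = 0"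
      by (simp add: AE_iff_null_sets null_setsD1)
    then show False using emeasure_open_cube[of "{1..n}"] by (simp add: lebesgue_n_def)
  qed
  then have "K n P \<noteq> 0"
    unfolding K_eq_open by (subst nn_integral_0_iff_AE) auto
  then show ?thesis by (simp add: zero_less_iff_neq_zero)
qed

section \<open>The integral in the last variable\<close>

definition K_initial_factor :: "nat \<Rightarrow> int vec \<Rightarrow> (nat \<Rightarrow> real) \<Rightarrow> real" where
  "K_initial_factor n P y =
     (\<Prod>k\<in>{1..<n}. y k powi parA n P k * (1 - y k) powi parB n P k) /
     (\<Prod>k\<in>{2..<n}. (1 - (\<Prod>j=1..k. y j)) powi (parC n P k + 1))"

text \<open>The variable y_n occurs in the full product y_1...y_n and in no shorter one, hence in
  one factor of the numerator product and one of the denominator. What remains in \<open>t\<close>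
  is an Euler integrand with x = y_1...y_{n-1}.\<close>

lemma K_integrand_last:
  assumes "2 \<le> n"
  shows "K_integrand n P (y(n := t)) = K_initial_factor n P y *
    (t powi parA n P n * (1 - t) powi parB n P n / (1 - (\<Prod>j\<in>{1..<n}. y j) * t) powi (parC n P n + 1))"
proof -
  have split: "{1..n} = insert n {1..<n}" "{2..n} = insert n {2..<n}" using assms by auto
  have *: "(\<Prod>j=1..k. (y(n := t)) j) = (\<Prod>j=1..k. y j)" if "k < n" for k
    using that by (intro prod.cong) auto
  have **: "(\<Prod>j=1..n. (y(n := t)) j) = (\<Prod>j\<in>{1..<n}. y j) * t"
    unfolding split by (simp add: mult.commute)
  have num: "(\<Prod>k=1..n. (y(n := t)) k powi parA n P k * (1 - (y(n := t)) k) powi parB n P k) =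
    (t powi parA n P n * (1 - t) powi parB n P n) *
    (\<Prod>k\<in>{1..<n}. y k powi parA n P k * (1 - y k) powi parB n P k)"
    unfolding split(1) by (subst prod.insert) (auto intro!: arg_cong2[where f = "(*)"] prod.cong)
  have den: "(\<Prod>k=2..n. (1 - (\<Prod>j=1..k. (y(n := t)) j)) powi (parC n P k + 1)) =
    (1 - (\<Prod>j\<in>{1..<n}. y j) * t) powi (parC n P n + 1) *
    (\<Prod>k\<in>{2..<n}. (1 - (\<Prod>j=1..k. y j)) powi (parC n P k + 1))"
  proof -
    have "(\<Prod>k\<in>{2..<n}. (1 - (\<Prod>j=1..k. (y(n := t)) j)) powi (parC n P k + 1)) =
      (\<Prod>k\<in>{2..<n}. (1 - (\<Prod>j=1..k. y j)) powi (parC n P k + 1))"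
      by (intro prod.cong refl) (simp only: * atLeastLessThan_iff)
    moreover have "n \<notin> {2..<n}" by simp
    ultimately show ?thesis
      unfolding split(2) by (simp only: prod.insert[OF finite_atLeastLessThan] ** simp_thms)
  qed
  show ?thesis
    unfolding K_integrand_def K_initial_factor_def num den by (simp add: mult_ac)
qed

text \<open>Open cube outside and closed interval inside, to match the form of
  \<open>hypergeometric_in_last_variable\<close>, which assumes 0 < y_k < 1 for the fixed
  variables.\<close>

lemma K_Tonelli:
  assumes "2 \<le> n"
  shows "K n P = (\<integral>\<^sup>+y. indicator (open_cube {1..<n}) y *
     (\<integral>\<^sup>+t\<in>{0..1}. ennreal (K_integrand n P (y(n := t))) \<partial>lborel) \<partial>PiM {1..<n} (\<lambda>_. lborel))"
proof -
  have split: "{1..n} = insert n {1..<n}" using assms by auto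
  have "K n P = (\<integral>\<^sup>+y. (\<integral>\<^sup>+t. indicator (open_cube {1..n}) (y(n := t)) *
      ennreal (K_integrand n P (y(n := t))) \<partial>lborel) \<partial>PiM {1..<n} (\<lambda>_. lborel))"
  proof -
    have "(\<lambda>y. indicator (open_cube {1..n}) y * ennreal (K_integrand n P y)) \<in> borel_measurable (lebesgue_n n)"
      by auto
    then show ?thesis
      unfolding K_eq_open lebesgue_n_def split
      by (subst lborel_family.product_nn_integral_insert) auto
  qed
  also have "\<dots> = (\<integral>\<^sup>+y. indicator (open_cube {1..<n}) y *
     (\<integral>\<^sup>+t\<in>{0..1}. ennreal (K_integrand n P (y(n := t))) \<partial>lborel) \<partial>PiM {1..<n} (\<lambda>_. lborel))"
  proof (rule nn_integral_cong)
    fix y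
    have "indicator (open_cube {1..n}) (y(n := t)) = (indicator (open_cube {1..<n}) y * indicator {0<..<1} t :: ennreal)" for t
      unfolding split by (auto simp: open_cube_def indicator_def)
    then show "(\<integral>\<^sup>+t. indicator (open_cube {1..n}) (y(n := t)) * ennreal (K_integrand n P (y(n := t))) \<partial>lborel) =
      indicator (open_cube {1..<n}) y * (\<integral>\<^sup>+t\<in>{0..1}. ennreal (K_integrand n P (y(n := t))) \<partial>lborel)"
      unfolding nn_integral_Icc_Ioo
      by (cases "y \<in> open_cube {1..<n}") (auto intro!: nn_integral_cong simp: mult.commute)
  qed
  finally show ?thesis .
qed

lemma measurable_inner_integral:
  assumes "2 \<le> n"
  shows "(\<lambda>y. \<integral>\<^sup>+t\<in>{0..1}. ennreal (K_integrand n P (y(n := t))) \<partial>lborel)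
    \<in> borel_measurable (PiM {1..<n} (\<lambda>_. lborel))"
proof -
  have split: "{1..n} = insert n {1..<n}" using assms by auto
  have upd: "(\<lambda>z. (fst z)(n := snd z)) \<in> measurable (PiM {1..<n} (\<lambda>_. lborel) \<Otimes>\<^sub>M (lborel :: real measure)) (lebesgue_n n)"
    unfolding lebesgue_n_def split
    using measurable_add_dim[of n "{1..<n}" "\<lambda>_. lborel :: real measure"] by (simp add: split_beta')
  have "(\<lambda>z. ennreal (K_integrand n P ((fst z)(n := snd z))) * indicator {0..1} (snd z))
    \<in> borel_measurable (PiM {1..<n} (\<lambda>_. lborel) \<Otimes>\<^sub>M (lborel :: real measure))"
    using measurable_compose[OF upd K_integrand_measurable] by measurable
  then show ?thesis
    by (intro lborel.borel_measurable_nn_integral) (simp add: split_beta')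
qed

text \<open>For y in the open cube, x = y_1...y_{n-1} is less than 1, so 1 - x t does not vanish on
  [0, 1]. A negative A_n or B_n then leaves a pole at t = 0 or t = 1 whose integral diverges for
  each such y, that is, on a set of measure one.\<close>

lemma K_finite_imp_nonneg:
  assumes "2 \<le> n" "K n P \<noteq> \<infinity>"
  shows "0 \<le> parA n P n \<and> 0 \<le> parB n P n"
proof (rule ccontr)
  assume neg: "\<not> ?thesis"
  have "(\<integral>\<^sup>+t\<in>{0..1}. ennreal (K_integrand n P (y(n := t))) \<partial>lborel) = \<infinity>"
    if y: "y \<in> open_cube {1..<n}" for y
  proof -
    define x where "x = (\<Prod>j\<in>{1..<n}. y j)"
    have x: "0 < x" "x < 1"
      unfolding x_def using assms(1) y by (auto intro!: prod_in_unit simp: open_cube_def)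
    have "(\<Prod>j=1..k. y j) < 1" if "k \<in> {2..<n}" for k
      using y that by (intro prod_in_unit) (auto simp: open_cube_def)
    then have G: "0 < K_initial_factor n P y"
      using y unfolding K_initial_factor_def
      by (intro divide_pos_pos prod_pos) (auto simp: open_cube_def intro!: mult_pos_pos zero_less_power_int)
    have xt: "x * t < 1" if "t \<in> {0..1}" for t
    proof -
      have "x * t \<le> x" using that x by (simp add: mult_left_le)
      then show ?thesis using x by linarith
    qed
    then have ne: "x * t \<noteq> 1" if "0 \<le> t" "t \<le> 1" for t
      using that by force
    consider "parA n P n < 0" | "parB n P n < 0" using neg by linarith
    then show ?thesis
    proof cases
      case 1
      have "(\<integral>\<^sup>+t\<in>{0<..<1}. ennreal (t powi parA n P n * (K_initial_factor n P y *
        ((1 - t) powi parB n P n / (1 - x * t) powi (parC n P n + 1)))) \<partial>lborel) = \<infinity>"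
      proof (rule nn_integral_pole_at_0)
        show "continuous_on {0..1/2} (\<lambda>t. K_initial_factor n P y *
          ((1 - t) powi parB n P n / (1 - x * t) powi (parC n P n + 1)))"
          by (intro continuous_intros) (auto simp: power_int_eq_0_iff ne)
        show "0 < K_initial_factor n P y * ((1 - t) powi parB n P n / (1 - x * t) powi (parC n P n + 1))"
          if "t \<in> {0..1/2}" for t
          using G xt[of t] that by (intro mult_pos_pos divide_pos_pos zero_less_power_int) auto
      qed (use 1 in auto)
      then show ?thesis
        unfolding nn_integral_Icc_Ioo K_integrand_last[OF assms(1)] x_def[symmetric]
        by (simp add: mult_ac)
    next
      case 2
      have "(\<integral>\<^sup>+t\<in>{0<..<1}. ennreal ((1 - t) powi parB n P n * (K_initial_factor n P y *
        (t powi parA n P n / (1 - x * t) powi (parC n P n + 1)))) \<partial>lborel) = \<infinity>"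
      proof (rule nn_integral_pole_at_1)
        show "continuous_on {1/2..1} (\<lambda>t. K_initial_factor n P y *
          (t powi parA n P n / (1 - x * t) powi (parC n P n + 1)))"
          by (intro continuous_intros) (auto simp: power_int_eq_0_iff ne)
        show "0 < K_initial_factor n P y * (t powi parA n P n / (1 - x * t) powi (parC n P n + 1))"
          if "t \<in> {1/2..1}" for t
          using G xt[of t] that by (intro mult_pos_pos divide_pos_pos zero_less_power_int) auto
      qed (use 2 in auto)
      then show ?thesis
        unfolding nn_integral_Icc_Ioo K_integrand_last[OF assms(1)] x_def[symmetric]
        by (simp add: mult_ac)
    qed
  qed
  then have "K n P = (\<integral>\<^sup>+y. \<infinity> * indicator (PiE {1..<n} (\<lambda>_. {0<..<1::real})) y \<partial>PiM {1..<n} (\<lambda>_. lborel))"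
    unfolding K_Tonelli[OF assms(1)]
    by (intro nn_integral_cong) (auto simp: indicator_def open_cube_def space_PiM PiE_iff)
  also have "\<dots> = \<infinity> * emeasure (PiM {1..<n} (\<lambda>_. lborel)) (PiE {1..<n} (\<lambda>_. {0<..<1::real}))"
    by (intro nn_integral_cmult_indicator sets_PiM_I_finite) auto
  also have "\<dots> = \<infinity>" by (simp add: emeasure_open_cube)
  finally show False using assms(2) by simp
qed

text \<open>\<open>chi_fun\<close> alters only the parameters with index n, so the initial factor
  and x are common to both sides. With d = a + b - c, the remaining identity is
  \<open>euler_integral_symmetry\<close>.\<close>

lemma hypergeometric_chi:
  assumes "2 \<le> n"
  shows "hypergeometric_in_last_variable n (chi_mat n)"
  unfolding hypergeometric_in_last_variable_def Let_def
proof (intro ballI allI impI, elim conjE)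
  fix P :: "int vec" and y :: "nat \<Rightarrow> real"
  assume P: "P \<in> carrier_vec (3 * n - 1)"
  define a b c d where "a = nat (parA n P n)" and "b = nat (parB n P n)" and "c = nat (parC n P n)"
    and "d = nat (parA n P n + parB n P n - parC n P n)"
  assume nonneg: "0 \<le> parA n P n" "0 \<le> parB n P n" "0 \<le> parC n P n" "parC n P n \<le> parA n P n + parB n P n"
    and y: "\<forall>k\<in>{1..<n}. 0 < y k \<and> y k < 1"
  define x where "x = (\<Prod>j\<in>{1..<n}. y j)"
  have x: "0 < x" "x < 1"
    unfolding x_def using assms y by (auto intro!: prod_in_unit)
  have G: "0 \<le> K_initial_factor n P y"
  proof -
    have "(\<Prod>j=1..k. y j) < 1" if "k \<in> {2..<n}" for k
      using y that by (intro prod_in_unit) auto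
    then show ?thesis
      using y unfolding K_initial_factor_def
      by (intro divide_nonneg_nonneg prod_nonneg)
        (auto intro!: mult_nonneg_nonneg zero_le_power_int simp: less_imp_le)
  qed
  have par: "parA n P n = int a" "parB n P n = int b" "parC n P n = int c"
      "parA n P n + parB n P n - parC n P n = int d"
    using nonneg by (simp_all add: a_def b_def c_def d_def)
  have chi: "parA n (chi_fun n P) n = int c" "parB n (chi_fun n P) n = int d" "parC n (chi_fun n P) n = int a"
    using assms par by (simp_all add: chi_fun_def par_mk_param)
  have same: "K_initial_factor n (chi_fun n P) y = K_initial_factor n P y"
    unfolding K_initial_factor_def
    by (intro arg_cong2[where f = "(/)"] prod.cong) (auto simp: chi_fun_def par_mk_param)
  have nat_powi: "z powi (int m + 1) = z ^ (m + 1)" for z :: real and m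
    using power_int_of_nat[of z "m + 1"] by (simp add: add.commute)
  have inner: "(\<integral>\<^sup>+t\<in>{0..1}. ennreal (K_integrand n Q (y(n := t))) \<partial>lborel) =
      ennreal (K_initial_factor n P y) *
      (\<integral>\<^sup>+t\<in>{0..1}. ennreal (t ^ i * (1 - t) ^ j / (1 - x * t) ^ (k + 1)) \<partial>lborel)"
    if "parA n Q n = int i" "parB n Q n = int j" "parC n Q n = int k"
      "K_initial_factor n Q y = K_initial_factor n P y" for Q i j k
    unfolding K_integrand_last[OF assms] x_def[symmetric] that nat_powi power_int_of_nat
    by (simp only: ennreal_mult'[OF G] mult.assoc, rule nn_integral_cmult) auto
  have "a + b = c + d" using nonneg by (simp add: a_def b_def c_def d_def)
  note sym = euler_integral_symmetry[OF less_imp_le[OF x(1)] x(2) this]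
  show "ennreal (fact (nat (parC n P n)) * fact (nat (parA n P n + parB n P n - parC n P n))) *
      (\<integral>\<^sup>+t\<in>{0..1}. ennreal (K_integrand n P (y(n := t))) \<partial>lborel) =
    ennreal (fact (nat (parA n P n)) * fact (nat (parB n P n))) *
      (\<integral>\<^sup>+t\<in>{0..1}. ennreal (K_integrand n (chi_mat n *\<^sub>v P) (y(n := t))) \<partial>lborel)"
    unfolding chi_mat_mult_vec[OF assms P] inner[OF par(1-3) refl] inner[OF chi same]
      a_def[symmetric] b_def[symmetric] c_def[symmetric] d_def[symmetric]
    by (simp only: mult.left_commute[of _ "ennreal (K_initial_factor n P y)"] sym)
qed

text \<open>The factorial constants are independent of y, so the hypergeometric identity integrates
  over the other variables. Finiteness of \<open>K n P\<close> enters through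
  \<open>K_finite_imp_nonneg\<close>.\<close>

lemma K_chi_ratio:
  assumes n: "2 \<le> n" and P: "P \<in> carrier_vec (3 * n - 1)" and fin: "K n P \<noteq> \<infinity>"
    and c: "0 \<le> parC n P n" "parC n P n \<le> parA n P n + parB n P n"
  shows "\<exists>q::rat. 0 < q \<and> K n (chi_fun n P) = ennreal (of_rat q) * K n P"
proof -
  let ?I = "\<lambda>P y. \<integral>\<^sup>+t\<in>{0..1}. ennreal (K_integrand n P (y(n := t))) \<partial>lborel"
  define u v :: rat where
    "u = fact (nat (parC n P n)) * fact (nat (parA n P n + parB n P n - parC n P n))" and
    "v = fact (nat (parA n P n)) * fact (nat (parB n P n))"
  have uv: "0 < u" "0 < v" by (simp_all add: u_def v_def)
  have of_rat_fact: "of_rat (fact m) = (fact m :: real)" for m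
    using of_rat_of_nat_eq[of "fact m", where 'a = real] by simp
  have r: "of_rat u = fact (nat (parC n P n)) * (fact (nat (parA n P n + parB n P n - parC n P n)) :: real)"
    "of_rat v = fact (nat (parA n P n)) * (fact (nat (parB n P n)) :: real)"
    by (simp_all add: u_def v_def of_rat_mult of_rat_fact)
  have meas: "(\<lambda>y. indicator (open_cube {1..<n}) y * ?I Q y) \<in> borel_measurable (PiM {1..<n} (\<lambda>_. lborel))" for Q
  proof -
    have eq: "{1..<n} = {1..n - 1}" using n by auto
    have "(indicator (open_cube {1..<n}) :: _ \<Rightarrow> ennreal) \<in> borel_measurable (PiM {1..<n} (\<lambda>_. lborel))"
      using pred_open_cube[of "{1..n - 1}" "n - 1"] unfolding lebesgue_n_def eq by simp
    then show ?thesis using measurable_inner_integral[OF n] by auto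
  qed
  have "ennreal (of_rat u) * K n P = ennreal (of_rat v) * K n (chi_fun n P)"
  proof -
    have "ennreal (of_rat u) * (indicator (open_cube {1..<n}) y * ?I P y) =
        ennreal (of_rat v) * (indicator (open_cube {1..<n}) y * ?I (chi_fun n P) y)" for y
      using hypergeometric_chi[OF n] P c K_finite_imp_nonneg[OF n fin]
      unfolding hypergeometric_in_last_variable_def Let_def r chi_mat_mult_vec[OF n P, symmetric]
      by (auto simp: indicator_def open_cube_def)
    then show ?thesis
      unfolding K_Tonelli[OF n] by (simp only: nn_integral_cmult[OF meas, symmetric])
  qed
  then have "ennreal (of_rat (1 / v)) * (ennreal (of_rat u) * K n P) =
      ennreal (of_rat (1 / v)) * (ennreal (of_rat v) * K n (chi_fun n P))" by simp
  then have "ennreal (of_rat (u / v)) * K n P = K n (chi_fun n P)"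
    using uv by (simp add: mult.assoc[symmetric] ennreal_mult[symmetric] of_rat_mult[symmetric])
  then show ?thesis using uv by (intro exI[of _ "u / v"]) simp
qed

section \<open>Changes of variables\<close>

text \<open>Serves both \<open>sigma_map\<close> (with \<open>f = id\<close>) and
  \<open>reflect\<close> (with f x = 1 - x). The preimage of a box is a box with permuted sides of
  equal measure, and boxes determine the product measure.\<close>

lemma distr_lebesgue_n_permute:
  fixes f :: "real \<Rightarrow> real"
  assumes [measurable]: "f \<in> borel_measurable borel" and f: "distr lborel lborel f = lborel"
    and p: "bij_betw p {1..n} {1..n}"
  shows "distr (lebesgue_n n) (lebesgue_n n) (\<lambda>y. \<lambda>k\<in>{1..n}. f (y (p k))) = lebesgue_n n"
    and "(\<lambda>y. \<lambda>k\<in>{1..n}. f (y (p k))) \<in> measurable (lebesgue_n n) (lebesgue_n n)"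
proof -
  let ?I = "{1..n}" and ?\<phi> = "\<lambda>y. \<lambda>k\<in>{1..n}. f (y (p k))"
  have p_in: "p k \<in> ?I" if "k \<in> ?I" for k
    using p that by (auto simp: bij_betw_def)
  define q where "q = inv_into ?I p"
  have q: "bij_betw q ?I ?I" unfolding q_def by (rule bij_betw_inv_into[OF p])
  have pq: "p (q k) = k" "q (p k) = k" "q k \<in> ?I" if "k \<in> ?I" for k
    using p that bij_betw_apply[OF q that]
    by (simp_all add: q_def bij_betw_inv_into_right bij_betw_inv_into_left)
  have \<phi>: "?\<phi> \<in> measurable (lebesgue_n n) (lebesgue_n n)"
    using p_in by (intro measurable_lebesgue_nI measurable_compose[OF measurable_coordinate_lebesgue_n, of _ n f]) auto
  then show "?\<phi> \<in> measurable (lebesgue_n n) (lebesgue_n n)" .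
  show "distr (lebesgue_n n) (lebesgue_n n) ?\<phi> = lebesgue_n n"
    unfolding lebesgue_n_def[of n]
  proof (rule lborel_family.PiM_eqI)
    fix A :: "nat \<Rightarrow> real set"
    assume A: "\<And>i. i \<in> ?I \<Longrightarrow> A i \<in> sets lborel"
    have pre: "?\<phi> -` PiE ?I A \<inter> space (PiM ?I (\<lambda>_. lborel)) = PiE ?I (\<lambda>i. f -` A (q i))"
    proof -
      have eq: "(\<forall>k\<in>?I. f (y (p k)) \<in> A k) \<longleftrightarrow> (\<forall>i\<in>?I. f (y i) \<in> A (q i))" for y
      proof safe
        fix i assume "\<forall>k\<in>?I. f (y (p k)) \<in> A k" "i \<in> ?I"
        then show "f (y i) \<in> A (q i)" using pq(1,3)[of i] by metis
      next
        fix k assume "\<forall>i\<in>?I. f (y i) \<in> A (q i)" "k \<in> ?I"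
        then show "f (y (p k)) \<in> A k" using pq(2)[of k] p_in[of k] by metis
      qed
      show ?thesis
      proof (rule Set.set_eqI)
        fix y
        have "y \<in> ?\<phi> -` PiE ?I A \<inter> space (PiM ?I (\<lambda>_. lborel)) \<longleftrightarrow>
            y \<in> extensional ?I \<and> (\<forall>k\<in>?I. f (y (p k)) \<in> A k)"
          by (auto simp: space_PiM PiE_iff)
        also have "\<dots> \<longleftrightarrow> y \<in> PiE ?I (\<lambda>i. f -` A (q i))"
          unfolding eq by (auto simp: PiE_iff)
        finally show "y \<in> ?\<phi> -` PiE ?I A \<inter> space (PiM ?I (\<lambda>_. lborel)) \<longleftrightarrow>
            y \<in> PiE ?I (\<lambda>i. f -` A (q i))" .
      qed
    qed
    have meas: "f -` A (q i) \<in> sets lborel" if "i \<in> ?I" for i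
      using measurable_sets[of f borel borel "A (q i)"] A[of "q i"] pq(3)[OF that] by simp
    have "emeasure (distr (PiM ?I (\<lambda>_. lborel)) (PiM ?I (\<lambda>_. lborel)) ?\<phi>) (PiE ?I A) =
        emeasure (PiM ?I (\<lambda>_. lborel)) (PiE ?I (\<lambda>i. f -` A (q i)))"
      using \<phi> A unfolding lebesgue_n_def
      by (subst emeasure_distr) (auto simp only: pre intro!: sets_PiM_I_finite)
    also have "\<dots> = (\<Prod>i\<in>?I. emeasure lborel (f -` A (q i)))"
      using meas by (intro lborel_family.emeasure_PiM) auto
    also have "\<dots> = (\<Prod>i\<in>?I. emeasure lborel (A (q i)))"
    proof (rule prod.cong)
      fix i assume "i \<in> ?I"
      then have "A (q i) \<in> sets lborel" using A pq by simp
      then have "emeasure (distr lborel lborel f) (A (q i)) = emeasure lborel (f -` A (q i))"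
        by (subst emeasure_distr) auto
      then show "emeasure lborel (f -` A (q i)) = emeasure lborel (A (q i))" by (simp add: f)
    qed simp
    also have "\<dots> = (\<Prod>i\<in>?I. emeasure lborel (A i))"
      by (rule prod.reindex_bij_betw[OF q])
    finally show "emeasure (distr (PiM ?I (\<lambda>_. lborel)) (PiM ?I (\<lambda>_. lborel)) ?\<phi>) (PiE ?I A) =
      (\<Prod>i\<in>?I. emeasure lborel (A i))" .
  qed auto
qed

lemma K_measure_space: "K n P = emeasure (K_measure n P) (space (lebesgue_n n))"
proof -
  have "unit_cube n \<in> sets (lebesgue_n n)"
    unfolding lebesgue_n_def unit_cube_def by (auto intro!: sets_PiM_I_finite)
  then show ?thesis
    unfolding K_measure_def K_def by (subst emeasure_density) (auto intro!: nn_integral_cong)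
qed

text \<open>\<open>K n P\<close> is the total mass of \<open>K_measure n P\<close>, and a
  push-forward keeps the total mass.\<close>

lemma induced_imp_K_eq:
  assumes "induced_by_change_of_variables n g \<phi>" "P \<in> carrier_vec (3 * n - 1)"
  shows "K n (g *\<^sub>v P) = K n P"
proof -
  have \<phi>: "\<phi> \<in> measurable (lebesgue_n n) (lebesgue_n n)"
    and eq: "distr (K_measure n P) (lebesgue_n n) \<phi> = K_measure n (g *\<^sub>v P)"
    using assms by (auto simp: induced_by_change_of_variables_def)
  have sp: "space (K_measure n P) = space (lebesgue_n n)" and se: "sets (K_measure n P) = sets (lebesgue_n n)"
    by (simp_all add: K_measure_def)
  have "\<phi> \<in> measurable (K_measure n P) (lebesgue_n n)"
    using \<phi> measurable_cong_sets[OF se refl] by blast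
  then have "emeasure (distr (K_measure n P) (lebesgue_n n) \<phi>) (space (lebesgue_n n)) =
      emeasure (K_measure n P) (space (lebesgue_n n))"
    by (subst emeasure_distr) (auto simp: sp measurable_space Int_absorb1 subset_eq)
  then show ?thesis unfolding eq by (simp add: K_measure_space)
qed

lemma sigma_change_of_variables:
  assumes "2 \<le> n"
  shows "induced_by_change_of_variables n (sigma_mat n) (sigma_map n)"
proof -
  let ?p = "Transposition.transpose 1 (2::nat)"
  have bij: "bij_betw ?p {1..n} {1..n}"
    using assms by (intro bij_betwI[of _ _ _ ?p]) (auto simp: Transposition.transpose_def)
  have map: "sigma_map n = (\<lambda>y. \<lambda>k\<in>{1..n}. id (y (?p k)))"
    by (simp add: sigma_map_def fun_eq_iff)
  have id: "distr lborel lborel (id :: real \<Rightarrow> real) = lborel"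
    unfolding id_def by (rule distr_id)
  note distr = distr_lebesgue_n_permute[OF _ id bij, folded map, simplified]
  have cube: "unit_cube n \<in> sets (lebesgue_n n)"
    unfolding lebesgue_n_def unit_cube_def by (auto intro!: sets_PiM_I_finite)
  show ?thesis
    unfolding induced_by_change_of_variables_def
  proof (intro conjI ballI)
    show "sigma_map n \<in> measurable (lebesgue_n n) (lebesgue_n n)" by (rule distr(2))
    fix P :: "int vec" assume P: "P \<in> carrier_vec (3 * n - 1)"
    let ?Q = "sigma_fun n P"
    have "K_integrand n ?Q (sigma_map n y) = K_integrand n P y" for y
    proof -
      have "(\<Prod>k=1..n. sigma_map n y k powi parA n ?Q k * (1 - sigma_map n y k) powi parB n ?Q k) =
        (\<Prod>k=1..n. y (?p k) powi parA n P (?p k) * (1 - y (?p k)) powi parB n P (?p k))"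
        by (intro prod.cong) (auto simp: sigma_map_def sigma_fun_def par_mk_param)
      also have "\<dots> = (\<Prod>k=1..n. y k powi parA n P k * (1 - y k) powi parB n P k)"
        by (rule prod.reindex_bij_betw[OF bij])
      finally have num: "(\<Prod>k=1..n. sigma_map n y k powi parA n ?Q k * (1 - sigma_map n y k) powi parB n ?Q k) =
        (\<Prod>k=1..n. y k powi parA n P k * (1 - y k) powi parB n P k)" .
      \<comment> \<open>The transposition permutes \<open>{1..k}\<close> once k is at least 2, and
        the denominator starts at k = 2.\<close>
      have "(\<Prod>j=1..k. sigma_map n y j) = (\<Prod>j=1..k. y j)" if "k \<in> {2..n}" for k
      proof -
        have "bij_betw ?p {1..k} {1..k}"
          using that by (intro bij_betwI[of _ _ _ ?p]) (auto simp: Transposition.transpose_def)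
        from prod.reindex_bij_betw[OF this, of y] show ?thesis
          using that by (auto simp: sigma_map_def)
      qed
      then have "(\<Prod>k=2..n. (1 - (\<Prod>j=1..k. sigma_map n y j)) powi (parC n ?Q k + 1)) =
        (\<Prod>k=2..n. (1 - (\<Prod>j=1..k. y j)) powi (parC n P k + 1))"
        by (intro prod.cong) (auto simp: sigma_fun_def par_mk_param)
      then show ?thesis unfolding K_integrand_def num by simp
    qed
    moreover have "indicator (unit_cube n) (sigma_map n y) = (indicator (unit_cube n) y :: ennreal)"
      if y: "y \<in> space (lebesgue_n n)" for y
    proof -
      have "(\<forall>k\<in>{1..n}. y (?p k) \<in> {0..1}) \<longleftrightarrow> (\<forall>k\<in>{1..n}. y k \<in> {0..1})"
        using bij by (metis (no_types, lifting) bij_betw_apply Transposition.transpose_involutory)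
      then show ?thesis
        using y by (auto simp: indicator_def unit_cube_def sigma_map_def space_lebesgue_n PiE_iff)
    qed
    ultimately have "K_measure n P = density (lebesgue_n n)
        (\<lambda>y. ennreal (K_integrand n ?Q (sigma_map n y)) * indicator (unit_cube n) (sigma_map n y))"
      unfolding K_measure_def using distr(2) cube by (intro density_cong) auto
    also have "distr \<dots> (lebesgue_n n) (sigma_map n) =
        density (distr (lebesgue_n n) (lebesgue_n n) (sigma_map n))
          (\<lambda>y. ennreal (K_integrand n ?Q y) * indicator (unit_cube n) y)"
      using distr(2) cube by (intro density_distr[symmetric]) auto
    also have "\<dots> = K_measure n ?Q" unfolding distr(1) K_measure_def ..
    finally show "distr (K_measure n P) (lebesgue_n n) (sigma_map n) = K_measure n (sigma_mat n *\<^sub>v P)"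
      using sigma_mat_mult_vec[OF assms P] by simp
  qed
qed

section \<open>Coordinates on the simplex\<close>

definition partial_products :: "nat \<Rightarrow> (nat \<Rightarrow> real) \<Rightarrow> nat \<Rightarrow> real" where
  "partial_products n y = (\<lambda>k\<in>{1..n}. \<Prod>j=1..k. y j)"

text \<open>Encodes t_0 = 1, so that the ratios t_k / t_{k-1} and the simplex inequalities are
  uniform in k.\<close>

definition prev :: "(nat \<Rightarrow> real) \<Rightarrow> nat \<Rightarrow> real" where
  "prev t k = (if k = 1 then 1 else t (k - 1))"

definition open_simplex :: "nat \<Rightarrow> (nat \<Rightarrow> real) set" where
  "open_simplex n = {t. \<forall>k\<in>{1..n}. 0 < t k \<and> t k < prev t k}"

lemma prev_measurable:
  "k \<in> {1..Suc n} \<Longrightarrow> (\<lambda>t. prev t k) \<in> borel_measurable (lebesgue_n n)"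
  unfolding prev_def by (cases "k = 1") (auto intro!: measurable_coordinate_lebesgue_n)

lemma indicator_open_simplex_measurable [measurable]:
  "indicator (open_simplex n) \<in> borel_measurable (lebesgue_n n)"
proof -
  have "Measurable.pred (lebesgue_n n) (\<lambda>t. \<forall>k\<in>{1..n}. 0 < t k \<and> t k < prev t k)"
    by (intro pred_intros_finite pred_intros_logic) (auto intro!: borel_measurable_pred_less prev_measurable)
  then show ?thesis
    unfolding open_simplex_def by (intro borel_measurable_indicator') auto
qed

lemma partial_products_measurable [measurable]:
  "partial_products n \<in> measurable (lebesgue_n n) (lebesgue_n n)"
  unfolding partial_products_def
  by (intro measurable_lebesgue_nI borel_measurable_prod measurable_coordinate_lebesgue_n) auto

lemma partial_products_Suc:
  "partial_products (Suc n) (x(Suc n := s)) =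
    (partial_products n x)(Suc n := prev (partial_products n x) (Suc n) * s)"
proof
  fix k
  consider "k \<in> {1..n}" | "k = Suc n" | "k \<notin> {1..Suc n}" by fastforce
  then show "partial_products (Suc n) (x(Suc n := s)) k =
    ((partial_products n x)(Suc n := prev (partial_products n x) (Suc n) * s)) k"
  proof cases
    case 1
    then show ?thesis by (auto simp: partial_products_def intro!: prod.cong)
  next
    case 2
    have "(\<Prod>j=1..n. (x(Suc n := s)) j) = (\<Prod>j=1..n. x j)" by (intro prod.cong) auto
    then show ?thesis using 2 by (auto simp: partial_products_def prev_def)
  next
    case 3
    then show ?thesis by (auto simp: partial_products_def)
  qed
qed

lemma lebesgue_n_Suc: "lebesgue_n (Suc n) = PiM (insert (Suc n) {1..n}) (\<lambda>_. lborel)"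
  unfolding lebesgue_n_def by (simp add: atLeastAtMostSuc_conv)

lemma nn_integral_lebesgue_n_Suc:
  assumes "f \<in> borel_measurable (lebesgue_n (Suc n))"
  shows "(\<integral>\<^sup>+y. f y \<partial>lebesgue_n (Suc n)) = (\<integral>\<^sup>+x. (\<integral>\<^sup>+s. f (x(Suc n := s)) \<partial>lborel) \<partial>lebesgue_n n)"
  using assms unfolding lebesgue_n_Suc lebesgue_n_def[of n]
  by (intro lborel_family.product_nn_integral_insert) auto

lemma simplex_weight_measurable [measurable]:
  "(\<lambda>t. ennreal (\<Prod>k\<in>{1..<n}. 1 / t k)) \<in> borel_measurable (lebesgue_n n)"
  by (intro measurable_compose[OF _ measurable_ennreal] borel_measurable_prod borel_measurable_divide
      measurable_coordinate_lebesgue_n) auto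

text \<open>The substitution is triangular: with the earlier products fixed, the last one is a
  multiple of the last variable, with factor t_{n-1}. Induction with Tonelli and scaling in one
  variable thus contributes 1 / t_{k-1} at each k, and the weight stops at index n - 1.\<close>

lemma nn_integral_partial_products:
  assumes "F \<in> borel_measurable (lebesgue_n n)"
  shows "(\<integral>\<^sup>+y. indicator (open_cube {1..n}) y * F (partial_products n y) \<partial>lebesgue_n n) =
    (\<integral>\<^sup>+t. indicator (open_simplex n) t * (ennreal (\<Prod>k\<in>{1..<n}. 1 / t k) * F t) \<partial>lebesgue_n n)"
  using assms
proof (induction n arbitrary: F)
  case 0
  have "partial_products 0 y = y" if "y \<in> space (lebesgue_n 0)" for y
    using that by (auto simp: partial_products_def space_lebesgue_n)
  then show ?case
    by (intro nn_integral_cong) (simp add: open_cube_def open_simplex_def)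
next
  case (Suc n)
  note F [measurable] = Suc.prems
  \<comment> \<open>\<open>G\<close> is \<open>F\<close> with the last variable integrated out; the
    induction hypothesis is applied to \<open>G\<close>, hence the generalization over
    \<open>F\<close>.\<close>
  define G where "G t = (\<integral>\<^sup>+s. indicator {0<..<1} s * F (t(Suc n := prev t (Suc n) * s)) \<partial>lborel)" for t
  have add_dim: "(\<lambda>z. (fst z)(Suc n := snd z)) \<in> measurable (lebesgue_n n \<Otimes>\<^sub>M (lborel :: real measure)) (lebesgue_n (Suc n))"
    unfolding lebesgue_n_Suc lebesgue_n_def[of n]
    using measurable_add_dim[of "Suc n" "{1..n}" "\<lambda>_. lborel :: real measure"] by (simp add: split_beta')
  have prev_Suc: "(\<lambda>t. prev t (Suc n)) \<in> borel_measurable (lebesgue_n n)"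
    by (rule prev_measurable) auto
  have "(\<lambda>z. (fst z, prev (fst z) (Suc n) * snd z)) \<in>
      measurable (lebesgue_n n \<Otimes>\<^sub>M (lborel :: real measure)) (lebesgue_n n \<Otimes>\<^sub>M (lborel :: real measure))"
    using measurable_compose[OF measurable_fst prev_Suc] by measurable
  from measurable_compose[OF measurable_compose[OF this add_dim] F]
  have [measurable]: "(\<lambda>z. F ((fst z)(Suc n := prev (fst z) (Suc n) * snd z)))
      \<in> borel_measurable (lebesgue_n n \<Otimes>\<^sub>M (lborel :: real measure))"
    by (simp add: fun_upd_def)
  have "(\<lambda>z. indicator {0<..<1} (snd z) * F ((fst z)(Suc n := prev (fst z) (Suc n) * snd z)))
      \<in> borel_measurable (lebesgue_n n \<Otimes>\<^sub>M (lborel :: real measure))"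
    by measurable
  then have G [measurable]: "G \<in> borel_measurable (lebesgue_n n)"
    unfolding G_def by (intro lborel.borel_measurable_nn_integral) (simp add: split_beta')
  have cube: "indicator (open_cube {1..Suc n}) (x(Suc n := s)) =
      (indicator (open_cube {1..n}) x * indicator {0<..<1} s :: ennreal)" for x s
    by (auto simp: open_cube_def indicator_def atLeastAtMostSuc_conv)
  have simplex: "indicator (open_simplex (Suc n)) (t(Suc n := u)) =
      (indicator (open_simplex n) t * indicator {0<..<prev t (Suc n)} u :: ennreal)" for t u
  proof -
    have "(\<forall>k\<in>{1..n}. 0 < (t(Suc n := u)) k \<and> (t(Suc n := u)) k < prev (t(Suc n := u)) k) \<longleftrightarrow>
        (\<forall>k\<in>{1..n}. 0 < t k \<and> t k < prev t k)"
      by (rule ball_cong) (auto simp: prev_def)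
    moreover have "prev (t(Suc n := u)) (Suc n) = prev t (Suc n)"
      by (simp add: prev_def)
    moreover have "{1..Suc n} = insert (Suc n) {1..n}" by auto
    ultimately have "t(Suc n := u) \<in> open_simplex (Suc n) \<longleftrightarrow>
        (0 < u \<and> u < prev t (Suc n)) \<and> t \<in> open_simplex n"
      unfolding open_simplex_def mem_Collect_eq by (simp only: ball_simps fun_upd_same)
    then show ?thesis by (auto simp: indicator_def)
  qed
  have weight: "(\<Prod>k\<in>{1..<Suc n}. 1 / (t(Suc n := u)) k) = (\<Prod>k\<in>{1..<n}. 1 / t k) * (1 / prev t (Suc n))" for t u
    by (cases "n = 0") (auto simp: prev_def atLeastLessThanSuc intro!: prod.cong)
  have "(\<integral>\<^sup>+y. indicator (open_cube {1..Suc n}) y * F (partial_products (Suc n) y) \<partial>lebesgue_n (Suc n)) =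
      (\<integral>\<^sup>+x. (\<integral>\<^sup>+s. indicator (open_cube {1..Suc n}) (x(Suc n := s)) *
         F (partial_products (Suc n) (x(Suc n := s))) \<partial>lborel) \<partial>lebesgue_n n)"
    by (intro nn_integral_lebesgue_n_Suc) auto
  also have "\<dots> = (\<integral>\<^sup>+x. indicator (open_cube {1..n}) x * G (partial_products n x) \<partial>lebesgue_n n)"
    unfolding cube partial_products_Suc G_def
  proof (rule nn_integral_cong)
    fix x
    show "(\<integral>\<^sup>+s. indicator (open_cube {1..n}) x * indicator {0<..<1} s *
        F ((partial_products n x)(Suc n := prev (partial_products n x) (Suc n) * s)) \<partial>lborel) =
      indicator (open_cube {1..n}) x *
      (\<integral>\<^sup>+s. indicator {0<..<1} s *
        F ((partial_products n x)(Suc n := prev (partial_products n x) (Suc n) * s)) \<partial>lborel)"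
      by (cases "x \<in> open_cube {1..n}") simp_all
  qed
  also have "\<dots> = (\<integral>\<^sup>+t. indicator (open_simplex n) t * (ennreal (\<Prod>k\<in>{1..<n}. 1 / t k) * G t) \<partial>lebesgue_n n)"
    by (rule Suc.IH[OF G])
  also have "\<dots> = (\<integral>\<^sup>+t. (\<integral>\<^sup>+u. indicator (open_simplex (Suc n)) (t(Suc n := u)) *
      (ennreal (\<Prod>k\<in>{1..<Suc n}. 1 / (t(Suc n := u)) k) * F (t(Suc n := u))) \<partial>lborel) \<partial>lebesgue_n n)"
  proof (rule nn_integral_cong)
    fix t assume t: "t \<in> space (lebesgue_n n)"
    show "indicator (open_simplex n) t * (ennreal (\<Prod>k\<in>{1..<n}. 1 / t k) * G t) =
      (\<integral>\<^sup>+u. indicator (open_simplex (Suc n)) (t(Suc n := u)) *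
      (ennreal (\<Prod>k\<in>{1..<Suc n}. 1 / (t(Suc n := u)) k) * F (t(Suc n := u))) \<partial>lborel)"
    proof (cases "t \<in> open_simplex n")
      case True
      define p where "p = prev t (Suc n)"
      have p: "0 < p" using True by (cases "n = 0") (auto simp: p_def prev_def open_simplex_def)
      have Ft [measurable]: "(\<lambda>u. F (t(Suc n := u))) \<in> borel_measurable borel"
        using measurable_compose[OF measurable_compose[OF measurable_Pair1'[OF t, of lborel] add_dim] F]
        by (simp add: fun_upd_def)
      have "(\<integral>\<^sup>+u. indicator {0<..<p} u * F (t(Suc n := u)) \<partial>lborel) =
          ennreal \<bar>p\<bar> * (\<integral>\<^sup>+s. indicator {0<..<p} (0 + p * s) * F (t(Suc n := 0 + p * s)) \<partial>lborel)"
        using p by (intro nn_integral_real_affine) auto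
      also have "(\<integral>\<^sup>+s. indicator {0<..<p} (0 + p * s) * F (t(Suc n := 0 + p * s)) \<partial>lborel) = G t"
        unfolding G_def p_def[symmetric] using p
        by (intro nn_integral_cong) (auto simp: indicator_def zero_less_mult_iff)
      finally have G_eq: "(\<integral>\<^sup>+u. indicator {0<..<p} u * F (t(Suc n := u)) \<partial>lborel) = ennreal p * G t"
        using p by (simp add: fun_upd_def)
      have w: "0 \<le> (\<Prod>k\<in>{1..<n}. 1 / t k)"
        using True by (intro prod_nonneg) (auto simp: open_simplex_def less_imp_le)
      have "(\<integral>\<^sup>+u. indicator (open_simplex (Suc n)) (t(Suc n := u)) *
          (ennreal (\<Prod>k\<in>{1..<Suc n}. 1 / (t(Suc n := u)) k) * F (t(Suc n := u))) \<partial>lborel) =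
          (\<integral>\<^sup>+u. ennreal ((\<Prod>k\<in>{1..<n}. 1 / t k) * (1 / p)) * (indicator {0<..<p} u * F (t(Suc n := u))) \<partial>lborel)"
        unfolding simplex weight p_def[symmetric] using True by (simp add: mult_ac)
      also have "\<dots> = ennreal ((\<Prod>k\<in>{1..<n}. 1 / t k) * (1 / p)) * (ennreal p * G t)"
        unfolding G_eq[symmetric] by (rule nn_integral_cmult) auto
      also have "\<dots> = ennreal (\<Prod>k\<in>{1..<n}. 1 / t k) * G t"
        using p w by (simp only: mult.assoc[symmetric] ennreal_mult[symmetric])
          (subst ennreal_mult[symmetric]; auto)
      finally show ?thesis using True by simp
    qed (simp add: simplex)
  qed
  also have "\<dots> = (\<integral>\<^sup>+t. indicator (open_simplex (Suc n)) t *
      (ennreal (\<Prod>k\<in>{1..<Suc n}. 1 / t k) * F t) \<partial>lebesgue_n (Suc n))"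
    by (intro nn_integral_lebesgue_n_Suc[symmetric] borel_measurable_times_ennreal
        indicator_open_simplex_measurable simplex_weight_measurable F)
  finally show ?case .
qed

text \<open>The inverse of \<open>partial_products\<close> between the open simplex and the open
  cube.\<close>

definition ratios :: "nat \<Rightarrow> (nat \<Rightarrow> real) \<Rightarrow> nat \<Rightarrow> real" where
  "ratios n t = (\<lambda>k\<in>{1..n}. t k / prev t k)"

definition reflect :: "nat \<Rightarrow> (nat \<Rightarrow> real) \<Rightarrow> nat \<Rightarrow> real" where
  "reflect n t = (\<lambda>k\<in>{1..n}. 1 - t (n + 1 - k))"

text \<open>The integrand in simplex coordinates, weight included. The shift for k < n is the
  Jacobian factor 1 / t_k, the shift for k > 1 is the summand 1 in the exponent C_k + 1. The two
  shifts are mirror images of each other.\<close>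

definition simplex_density :: "nat \<Rightarrow> int vec \<Rightarrow> (nat \<Rightarrow> real) \<Rightarrow> real" where
  "simplex_density n P t =
    (\<Prod>k=1..n. t k powi (crdE n P k - (if k < n then 1 else 0))) *
    (\<Prod>k=2..n. (t (k - 1) - t k) powi parB n P k) *
    (\<Prod>k=1..n. (1 - t k) powi (crdF n P k - (if 1 < k then 1 else 0)))"

lemma ratios_measurable [measurable]: "ratios n \<in> measurable (lebesgue_n n) (lebesgue_n n)"
  unfolding ratios_def
  by (intro measurable_lebesgue_nI borel_measurable_divide prev_measurable measurable_coordinate_lebesgue_n) auto

lemma distr_reflect:
  "distr (lebesgue_n n) (lebesgue_n n) (reflect n) = lebesgue_n n"
  "reflect n \<in> measurable (lebesgue_n n) (lebesgue_n n)"
proof -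
  have "bij_betw (\<lambda>k. n + 1 - k) {1..n} {1..n}"
    by (intro bij_betwI[of _ _ _ "\<lambda>k. n + 1 - k"]) auto
  moreover have "distr lborel lborel (\<lambda>x::real. 1 - x) = lborel"
  proof -
    have "lborel = distr lborel borel (\<lambda>x::real. 1 - x)"
      using lborel_real_affine[of "- 1" 1] by (simp add: density_1)
    moreover have "distr lborel lborel (\<lambda>x::real. 1 - x) = distr lborel borel (\<lambda>x::real. 1 - x)"
      by (intro distr_cong) auto
    ultimately show ?thesis by simp
  qed
  ultimately show "distr (lebesgue_n n) (lebesgue_n n) (reflect n) = lebesgue_n n"
    "reflect n \<in> measurable (lebesgue_n n) (lebesgue_n n)"
    unfolding reflect_def[abs_def] by (intro distr_lebesgue_n_permute; simp)+
qed

text \<open>The numerator of y'_k is 1 - t_{n+1-k}, the k-th reflected coordinate, and the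
  denominator is the preceding one. At k = 1 the convention y_{n+1} = 0 makes the denominator 1, in
  agreement with \<open>prev\<close>.\<close>

lemma theta_map_eq: "theta_map n y = ratios n (reflect n (partial_products n y))"
proof
  fix k
  show "theta_map n y k = ratios n (reflect n (partial_products n y)) k"
  proof (cases "k \<in> {1..n}")
    case True
    have eq: "(\<Prod>j=1..i. (y(n + 1 := 0)) j) = (\<Prod>j=1..i. y j)" if "i \<le> n" for i
      using that by (intro prod.cong) auto
    have zero: "(\<Prod>j=1..n + 1. (y(n + 1 := 0)) j) = 0"
      by (intro prod_zero) (auto intro!: bexI[of _ "n + 1"])
    have k: "n - k + 1 = n + 1 - k" "n + 1 - k \<in> {1..n}" using True by auto
    have reflect_partial: "reflect n (partial_products n y) i = 1 - (\<Prod>j=1..n + 1 - i. y j)"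
      if "i \<in> {1..n}" for i
    proof -
      have "n + 1 - i \<in> {1..n}" using that by auto
      then show ?thesis
        using that by (simp only: reflect_def partial_products_def restrict_apply if_True)
    qed
    have num: "1 - (\<Prod>j=1..n - k + 1. (y(n + 1 := 0)) j) = reflect n (partial_products n y) k"
      unfolding k(1) using eq[of "n + 1 - k"] k(2) reflect_partial[OF True] by simp
    have den: "1 - (\<Prod>j=1..n - k + 2. (y(n + 1 := 0)) j) = prev (reflect n (partial_products n y)) k"
    proof (cases "k = 1")
      case k1: True
      then have "n - k + 2 = n + 1" using True by auto
      then show ?thesis using k1 zero by (simp only: prev_def if_True diff_zero simp_thms)
    next
      case False
      then have "n - k + 2 = n + 1 - (k - 1)" "n + 1 - (k - 1) \<in> {1..n}" "k - 1 \<in> {1..n}"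
        using True by auto
      then show ?thesis
        using False eq[of "n + 1 - (k - 1)"] reflect_partial[of "k - 1"]
        by (simp only: prev_def if_False atLeastAtMost_iff simp_thms)
    qed
    show ?thesis
      using True num den by (simp only: theta_map_def Let_def ratios_def restrict_apply if_True)
  next
    case False
    then show ?thesis by (simp only: theta_map_def Let_def ratios_def restrict_apply if_False)
  qed
qed

lemma ratios_partial_products:
  assumes "y \<in> open_cube {1..n}" "y \<in> extensional {1..n}"
  shows "ratios n (partial_products n y) = y"
proof
  fix k
  show "ratios n (partial_products n y) k = y k"
  proof (cases "k \<in> {1..n}")
    case True
    show ?thesis
    proof (cases "k = 1")
      case False
      define m where "m = k - 1"
      have m: "k = Suc m" "m \<in> {1..n}" using True False by (auto simp: m_def)
      have "y j \<noteq> 0" if "j \<in> {1..m}" for j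
      proof -
        have "j \<in> {1..n}" using that m True by auto
        then have "0 < y j" using assms(1) by (simp add: open_cube_def)
        then show ?thesis by simp
      qed
      then show ?thesis
        using True m by (simp add: ratios_def partial_products_def prev_def)
    qed (use True in \<open>simp add: ratios_def partial_products_def prev_def\<close>)
  qed (use assms(2) in \<open>auto simp: ratios_def extensional_def\<close>)
qed

lemma prod_ratios:
  assumes "t \<in> open_simplex n" "k \<in> {1..n}"
  shows "(\<Prod>j=1..k. ratios n t j) = t k"
proof -
  have "1 \<le> k" using assms(2) by simp
  then show ?thesis using assms(2)
  proof (induction rule: dec_induct)
    case base
    then show ?case by (simp add: ratios_def prev_def)
  next
    case (step m)
    then have "0 < t m" using assms(1) by (auto simp: open_simplex_def)
    then show ?case using step by (simp add: ratios_def prev_def)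
  qed
qed

lemma open_simplex_less_1:
  assumes "t \<in> open_simplex n" "k \<in> {1..n}"
  shows "t k < 1"
proof -
  have "1 \<le> k" using assms(2) by simp
  then show ?thesis using assms(2)
  proof (induction rule: dec_induct)
    case base
    then show ?case using assms(1) by (auto simp: open_simplex_def prev_def dest: bspec[of _ _ 1])
  next
    case (step m)
    then have "t (Suc m) < t m" using assms(1) by (auto simp: open_simplex_def prev_def dest: bspec[of _ _ "Suc m"])
    then show ?case using step by simp
  qed
qed

lemma reflect_in_open_simplex:
  assumes t: "t \<in> open_simplex n"
  shows "reflect n t \<in> open_simplex n"
  unfolding open_simplex_def
proof (intro CollectI ballI conjI)
  fix k assume k: "k \<in> {1..n}"
  then have k': "n + 1 - k \<in> {1..n}" by auto
  show "0 < reflect n t k"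
    using open_simplex_less_1[OF t k'] k by (simp add: reflect_def)
  show "reflect n t k < prev (reflect n t) k"
  proof (cases "k = 1")
    case True
    then show ?thesis using t k by (auto simp: reflect_def prev_def open_simplex_def)
  next
    case False
    define m where "m = n + 1 - (k - 1)"
    have m: "m \<in> {1..n}" "m \<noteq> 1" "m - 1 = n + 1 - k" "k - 1 \<in> {1..n}"
      using False k by (auto simp: m_def)
    have "t m < prev t m" using t m(1) by (auto simp: open_simplex_def)
    then have "t m < t (n + 1 - k)" using m by (simp add: prev_def)
    then show ?thesis using False k m(4) by (simp add: reflect_def prev_def m_def)
  qed
qed

lemma reflect_reflect:
  assumes "t \<in> extensional {1..n}"
  shows "reflect n (reflect n t) = t"
proof
  fix k
  show "reflect n (reflect n t) k = t k"
  proof (cases "k \<in> {1..n}")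
    case True
    then have "n + 1 - k \<in> {1..n}" "n + 1 - (n + 1 - k) = k" by auto
    then show ?thesis using True by (simp add: reflect_def)
  qed (use assms in \<open>auto simp: reflect_def extensional_def\<close>)
qed

text \<open>With y_k = t_k / t_{k-1} and 1 - y_k = (t_{k-1} - t_k) / t_{k-1}, the powers of t_{k-1}
  in the denominators are collected at index k - 1, where they lower the exponent by A_k + B_k; this
  produces \<open>crdE\<close>.\<close>

lemma simplex_density_eq:
  assumes n: "2 \<le> n" and t: "t \<in> open_simplex n"
  shows "(\<Prod>k\<in>{1..<n}. 1 / t k) * K_integrand n P (ratios n t) = simplex_density n P t"
proof -
  have pos: "0 < t k" "0 < prev t k" if "k \<in> {1..n}" for k
    using t that by (auto simp: open_simplex_def intro: less_trans)
  have split_last: "{1..n} = insert n {1..<n}" and split_first: "{1..n} = insert 1 {2..n}"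
    using n by auto
  have "(\<Prod>k=1..n. ratios n t k powi parA n P k * (1 - ratios n t k) powi parB n P k) =
    (\<Prod>k=1..n. t k powi parA n P k * (prev t k - t k) powi parB n P k * prev t k powi (- parA n P k - parB n P k))"
  proof (rule prod.cong)
    fix k assume k: "k \<in> {1..n}"
    have "1 - t k / prev t k = (prev t k - t k) / prev t k" using pos[OF k] by (simp add: field_simps)
    then show "ratios n t k powi parA n P k * (1 - ratios n t k) powi parB n P k =
      t k powi parA n P k * (prev t k - t k) powi parB n P k * prev t k powi (- parA n P k - parB n P k)"
      using k pos[OF k]
      by (simp add: ratios_def power_int_divide_distrib power_int_diff power_int_minus field_simps)
  qed simp
  also have "\<dots> = (\<Prod>k=1..n. t k powi parA n P k) * (\<Prod>k=1..n. (prev t k - t k) powi parB n P k) *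
      (\<Prod>k=1..n. prev t k powi (- parA n P k - parB n P k))"
    by (simp add: prod.distrib)
  also have "(\<Prod>k=1..n. (prev t k - t k) powi parB n P k) =
      (1 - t 1) powi parB n P 1 * (\<Prod>k=2..n. (t (k - 1) - t k) powi parB n P k)"
    unfolding split_first by (subst prod.insert) (auto simp: prev_def intro!: prod.cong)
  also have "(\<Prod>k=1..n. prev t k powi (- parA n P k - parB n P k)) =
      (\<Prod>k\<in>{1..<n}. t k powi (- parA n P (k + 1) - parB n P (k + 1)))"
  proof -
    have "(\<Prod>k=1..n. prev t k powi (- parA n P k - parB n P k)) =
        (\<Prod>k=2..n. t (k - 1) powi (- parA n P k - parB n P k))"
      unfolding split_first by (subst prod.insert) (auto simp: prev_def intro!: prod.cong)
    also have "\<dots> = (\<Prod>k\<in>{1..<n}. t k powi (- parA n P (k + 1) - parB n P (k + 1)))"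
      by (rule prod.reindex_bij_witness[of _ "\<lambda>k. k + 1" "\<lambda>k. k - 1"]) auto
    finally show ?thesis .
  qed
  finally have num: "(\<Prod>k=1..n. ratios n t k powi parA n P k * (1 - ratios n t k) powi parB n P k) =
    (\<Prod>k=1..n. t k powi parA n P k) *
    ((1 - t 1) powi parB n P 1 * (\<Prod>k=2..n. (t (k - 1) - t k) powi parB n P k)) *
    (\<Prod>k\<in>{1..<n}. t k powi (- parA n P (k + 1) - parB n P (k + 1)))" .
  have den: "1 / (\<Prod>k=2..n. (1 - (\<Prod>j=1..k. ratios n t j)) powi (parC n P k + 1)) =
      (\<Prod>k=2..n. (1 - t k) powi (- parC n P k - 1))"
  proof -
    have inv: "z powi (- c - 1) = inverse (z powi (c + 1))" for z :: real and c
      using power_int_minus[of z "c + 1"] by simp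
    show ?thesis
      unfolding prod_dividef[symmetric, of "\<lambda>_. 1", simplified prod.neutral_const]
      using prod_ratios[OF t] by (auto intro!: prod.cong simp: inv divide_inverse)
  qed
  have E: "(\<Prod>k\<in>{1..<n}. 1 / t k) * (\<Prod>k=1..n. t k powi parA n P k) *
      (\<Prod>k\<in>{1..<n}. t k powi (- parA n P (k + 1) - parB n P (k + 1))) =
    (\<Prod>k=1..n. t k powi (crdE n P k - (if k < n then 1 else 0)))"
  proof -
    have "(\<Prod>k=1..n. t k powi (crdE n P k - (if k < n then 1 else 0))) =
      t n powi parA n P n * (\<Prod>k\<in>{1..<n}. t k powi (crdE n P k - 1))"
      unfolding split_last by (subst prod.insert) (auto simp: crdE_def intro!: prod.cong)
    also have "(\<Prod>k\<in>{1..<n}. t k powi (crdE n P k - 1)) =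
      (\<Prod>k\<in>{1..<n}. 1 / t k * t k powi parA n P k * t k powi (- parA n P (k + 1) - parB n P (k + 1)))"
    proof (rule prod.cong)
      fix k assume k: "k \<in> {1..<n}"
      then have "t k \<noteq> 0" using pos(1)[of k] by auto
      have eq: "crdE n P k - 1 = parA n P k + (- parA n P (k + 1) - parB n P (k + 1)) - 1"
        using k by (simp add: crdE_def)
      show "t k powi (crdE n P k - 1) =
        1 / t k * t k powi parA n P k * t k powi (- parA n P (k + 1) - parB n P (k + 1))"
        unfolding eq using \<open>t k \<noteq> 0\<close> power_int_diff[of "t k" "parA n P k + (- parA n P (k + 1) - parB n P (k + 1))" 1]
          power_int_add[of "t k" "parA n P k" "- parA n P (k + 1) - parB n P (k + 1)"]
        by simp
    qed simp
    finally have "(\<Prod>k=1..n. t k powi (crdE n P k - (if k < n then 1 else 0))) =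
      t n powi parA n P n * ((\<Prod>k\<in>{1..<n}. 1 / t k) * (\<Prod>k\<in>{1..<n}. t k powi parA n P k) *
        (\<Prod>k\<in>{1..<n}. t k powi (- parA n P (k + 1) - parB n P (k + 1))))"
      by (simp only: prod.distrib)
    moreover have "(\<Prod>k=1..n. t k powi parA n P k) =
      t n powi parA n P n * (\<Prod>k\<in>{1..<n}. t k powi parA n P k)"
      unfolding split_last by (subst prod.insert) auto
    ultimately show ?thesis by (simp only: mult_ac)
  qed
  have F: "(1 - t 1) powi parB n P 1 * (\<Prod>k=2..n. (1 - t k) powi (- parC n P k - 1)) =
    (\<Prod>k=1..n. (1 - t k) powi (crdF n P k - (if 1 < k then 1 else 0)))"
    unfolding split_first by (subst prod.insert) (auto simp: crdF_def intro!: prod.cong)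
  have "K_integrand n P (ratios n t) =
    (\<Prod>k=1..n. ratios n t k powi parA n P k * (1 - ratios n t k) powi parB n P k) *
    (1 / (\<Prod>k=2..n. (1 - (\<Prod>j=1..k. ratios n t j)) powi (parC n P k + 1)))"
    by (simp add: K_integrand_def)
  then show ?thesis
    unfolding num den simplex_density_def E[symmetric] F[symmetric] by (simp add: mult_ac)
qed

text \<open>Reversing the order of the products exchanges the factors t_k and 1 - t_{n+1-k}. A
  difference becomes a difference with index n + 2 - k, since it is labelled by the larger of its
  two indices.\<close>

lemma simplex_density_reflect:
  assumes "3 \<le> n"
  shows "simplex_density n P (reflect n t) = simplex_density n (theta_fun n P) t"
proof -
  have "(\<Prod>k=1..n. reflect n t k powi (crdE n P k - (if k < n then 1 else 0))) =
      (\<Prod>k=1..n. (1 - t k) powi (crdF n (theta_fun n P) k - (if 1 < k then 1 else 0)))"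
    by (rule prod.reindex_bij_witness[of _ "\<lambda>k. n + 1 - k" "\<lambda>k. n + 1 - k"])
      (use assms in \<open>auto simp: reflect_def crd_theta\<close>)
  moreover have "(\<Prod>k=2..n. (reflect n t (k - 1) - reflect n t k) powi parB n P k) =
      (\<Prod>k=2..n. (t (k - 1) - t k) powi parB n (theta_fun n P) k)"
  proof (rule prod.reindex_bij_witness[of _ "\<lambda>k. n + 2 - k" "\<lambda>k. n + 2 - k"])
    fix k assume k: "k \<in> {2..n}"
    then have "n + 1 - (k - 1) = n + 2 - k" "n + 2 - k - 1 = n + 1 - k" "k - 1 \<in> {1..n}" "k \<in> {1..n}"
      "n + 2 - k \<in> {2..n}" "n + 2 - (n + 2 - k) = k"
      by auto
    then show "(t (n + 2 - k - 1) - t (n + 2 - k)) powi parB n (theta_fun n P) (n + 2 - k) =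
      (reflect n t (k - 1) - reflect n t k) powi parB n P k"
      using crd_theta(3)[OF assms, of "n + 2 - k" P] by (simp only: reflect_def restrict_apply if_True) simp
  qed auto
  moreover have "(\<Prod>k=1..n. (1 - reflect n t k) powi (crdF n P k - (if 1 < k then 1 else 0))) =
      (\<Prod>k=1..n. t k powi (crdE n (theta_fun n P) k - (if k < n then 1 else 0)))"
    by (rule prod.reindex_bij_witness[of _ "\<lambda>k. n + 1 - k" "\<lambda>k. n + 1 - k"])
      (use assms in \<open>auto simp: reflect_def crd_theta\<close>)
  ultimately show ?thesis unfolding simplex_density_def by (simp add: mult_ac)
qed

lemma emeasure_K_measure:
  assumes "A \<in> sets (lebesgue_n n)"
  shows "emeasure (K_measure n P) A =
    (\<integral>\<^sup>+y. indicator (open_cube {1..n}) y * (ennreal (K_integrand n P y) * indicator A y) \<partial>lebesgue_n n)"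
proof -
  have "unit_cube n \<in> sets (lebesgue_n n)"
    unfolding lebesgue_n_def unit_cube_def by (auto intro!: sets_PiM_I_finite)
  then have "emeasure (K_measure n P) A =
      (\<integral>\<^sup>+y. ennreal (K_integrand n P y) * indicator (unit_cube n) y * indicator A y \<partial>lebesgue_n n)"
    unfolding K_measure_def using assms by (intro emeasure_density) auto
  also have "\<dots> = (\<integral>\<^sup>+y. indicator (open_cube {1..n}) y * (ennreal (K_integrand n P y) * indicator A y) \<partial>lebesgue_n n)"
    using AE_unit_cube[of n] by (intro nn_integral_cong_AE) (auto simp: mult_ac)
  finally show ?thesis .
qed

text \<open>The test function \<open>h\<close> makes this a statement about image measures, beyond
  their total mass. On the open cube y is recovered from its partial products by
  \<open>ratios\<close>, so the integrand is a function of t.\<close>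

lemma nn_integral_K_integrand_simplex:
  assumes n: "2 \<le> n" and h: "h \<in> borel_measurable (lebesgue_n n)"
  shows "(\<integral>\<^sup>+y. indicator (open_cube {1..n}) y * (ennreal (K_integrand n P y) * h (partial_products n y)) \<partial>lebesgue_n n) =
    (\<integral>\<^sup>+t. indicator (open_simplex n) t * (ennreal (simplex_density n P t) * h t) \<partial>lebesgue_n n)"
proof -
  have K: "(\<lambda>t. ennreal (K_integrand n P (ratios n t)) * h t) \<in> borel_measurable (lebesgue_n n)"
    using h measurable_compose[OF ratios_measurable K_integrand_measurable] by auto
  have "(\<integral>\<^sup>+y. indicator (open_cube {1..n}) y * (ennreal (K_integrand n P y) * h (partial_products n y)) \<partial>lebesgue_n n) =
    (\<integral>\<^sup>+y. indicator (open_cube {1..n}) y *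
      (ennreal (K_integrand n P (ratios n (partial_products n y))) * h (partial_products n y)) \<partial>lebesgue_n n)"
    by (intro nn_integral_cong) (auto simp: indicator_def space_lebesgue_n PiE_iff ratios_partial_products)
  also have "\<dots> = (\<integral>\<^sup>+t. indicator (open_simplex n) t *
      (ennreal (\<Prod>k\<in>{1..<n}. 1 / t k) * (ennreal (K_integrand n P (ratios n t)) * h t)) \<partial>lebesgue_n n)"
    by (rule nn_integral_partial_products[OF K])
  also have "\<dots> = (\<integral>\<^sup>+t. indicator (open_simplex n) t * (ennreal (simplex_density n P t) * h t) \<partial>lebesgue_n n)"
  proof (rule nn_integral_cong)
    fix t
    have "ennreal (\<Prod>k\<in>{1..<n}. 1 / t k) * ennreal (K_integrand n P (ratios n t)) = ennreal (simplex_density n P t)"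
      if t: "t \<in> open_simplex n"
    proof -
      have "0 \<le> (\<Prod>k\<in>{1..<n}. 1 / t k)"
        using t by (intro prod_nonneg) (auto simp: open_simplex_def less_imp_le)
      then show ?thesis
        using simplex_density_eq[OF n t] by (simp add: ennreal_mult'[symmetric])
    qed
    then show "indicator (open_simplex n) t *
      (ennreal (\<Prod>k\<in>{1..<n}. 1 / t k) * (ennreal (K_integrand n P (ratios n t)) * h t)) =
      indicator (open_simplex n) t * (ennreal (simplex_density n P t) * h t)"
      by (auto simp: indicator_def mult.assoc[symmetric])
  qed
  finally show ?thesis .
qed

lemma simplex_density_measurable [measurable]:
  "simplex_density n P \<in> borel_measurable (lebesgue_n n)"
  unfolding simplex_density_def
  by (intro borel_measurable_times borel_measurable_prod powi_borel_measurable borel_measurable_diff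
      measurable_coordinate_lebesgue_n) auto

text \<open>\<open>theta_map\<close> is passage to the simplex, \<open>reflect\<close>, and passage
  back. The middle map preserves both Lebesgue measure and the simplex, and carries the density for
  \<open>P\<close> to that for \<open>theta_fun n P\<close>.\<close>

lemma theta_change_of_variables:
  assumes n: "3 \<le> n"
  shows "induced_by_change_of_variables n (theta_mat n) (theta_map n)"
proof -
  have n2: "2 \<le> n" using n by simp
  have map: "theta_map n = (\<lambda>y. ratios n (reflect n (partial_products n y)))"
    by (rule ext) (rule theta_map_eq)
  have \<theta>: "theta_map n \<in> measurable (lebesgue_n n) (lebesgue_n n)"
    unfolding map using distr_reflect(2)[of n] by measurable
  show ?thesis
    unfolding induced_by_change_of_variables_def
  proof (intro conjI ballI \<theta>)
    fix P :: "int vec" assume P: "P \<in> carrier_vec (3 * n - 1)"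
    let ?Q = "theta_fun n P"
    have sets: "sets (K_measure n P) = sets (lebesgue_n n)" for P by (simp add: K_measure_def)
    have space: "space (K_measure n P) = space (lebesgue_n n)" by (simp add: K_measure_def)
    have "distr (K_measure n P) (lebesgue_n n) (theta_map n) = K_measure n ?Q"
    proof (rule measure_eqI)
      fix A assume "A \<in> sets (distr (K_measure n P) (lebesgue_n n) (theta_map n))"
      then have A [measurable]: "A \<in> sets (lebesgue_n n)" by simp
      have ind: "(\<lambda>t. indicator A (ratios n t) :: ennreal) \<in> borel_measurable (lebesgue_n n)"
        by measurable
      have ind': "(\<lambda>t. indicator A (ratios n (reflect n t)) :: ennreal) \<in> borel_measurable (lebesgue_n n)"
        by (rule measurable_compose[OF distr_reflect(2) ind])
      \<comment> \<open>Since \<open>reflect\<close> is an involution on extensional functions,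
        composing \<open>g\<close> with it leaves the indicator of \<open>A\<close> at
        \<open>ratios n t\<close>, ready for the passage back to the cube.\<close>
      define g where "g t = indicator (open_simplex n) t *
        (ennreal (simplex_density n P t) * indicator A (ratios n (reflect n t)))" for t
      have g: "g \<in> borel_measurable (lebesgue_n n)"
        unfolding g_def using ind' by auto
      have "theta_map n \<in> measurable (K_measure n P) (lebesgue_n n)"
        using \<theta> measurable_cong_sets[OF sets refl] by blast
      then have "emeasure (distr (K_measure n P) (lebesgue_n n) (theta_map n)) A =
          emeasure (K_measure n P) (theta_map n -` A \<inter> space (lebesgue_n n))"
        by (simp add: emeasure_distr space)
      also have "\<dots> = (\<integral>\<^sup>+y. indicator (open_cube {1..n}) y * (ennreal (K_integrand n P y) *
          indicator A (ratios n (reflect n (partial_products n y)))) \<partial>lebesgue_n n)"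
        by (subst emeasure_K_measure[OF measurable_sets[OF \<theta> A]])
          (auto intro!: nn_integral_cong simp: indicator_def theta_map_eq)
      also have "\<dots> = (\<integral>\<^sup>+t. g t \<partial>lebesgue_n n)"
        unfolding g_def by (rule nn_integral_K_integrand_simplex[OF n2 ind'])
      also have "\<dots> = (\<integral>\<^sup>+t. g t \<partial>distr (lebesgue_n n) (lebesgue_n n) (reflect n))"
        by (simp only: distr_reflect(1))
      also have "\<dots> = (\<integral>\<^sup>+t. g (reflect n t) \<partial>lebesgue_n n)"
        using distr_reflect(2) g by (intro nn_integral_distr) auto
      also have "\<dots> = (\<integral>\<^sup>+t. indicator (open_simplex n) t *
          (ennreal (simplex_density n ?Q t) * indicator A (ratios n t)) \<partial>lebesgue_n n)"
      proof (rule nn_integral_cong)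
        fix t assume "t \<in> space (lebesgue_n n)"
        then have inv: "reflect n (reflect n t) = t"
          by (intro reflect_reflect) (auto simp: space_lebesgue_n PiE_iff)
        then have "reflect n t \<in> open_simplex n \<longleftrightarrow> t \<in> open_simplex n"
          using reflect_in_open_simplex[of t n] reflect_in_open_simplex[of "reflect n t" n] by auto
        then show "g (reflect n t) = indicator (open_simplex n) t *
          (ennreal (simplex_density n ?Q t) * indicator A (ratios n t))"
          unfolding g_def inv simplex_density_reflect[OF n] by (simp add: indicator_def)
      qed
      also have "\<dots> = (\<integral>\<^sup>+y. indicator (open_cube {1..n}) y * (ennreal (K_integrand n ?Q y) *
          indicator A (ratios n (partial_products n y))) \<partial>lebesgue_n n)"
        by (rule nn_integral_K_integrand_simplex[OF n2 ind, symmetric])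
      also have "\<dots> = emeasure (K_measure n ?Q) A"
        unfolding emeasure_K_measure[OF A]
        by (intro nn_integral_cong) (auto simp: indicator_def space_lebesgue_n PiE_iff ratios_partial_products)
      finally show "emeasure (distr (K_measure n P) (lebesgue_n n) (theta_map n)) A = emeasure (K_measure n ?Q) A" .
    qed (simp add: sets)
    then show "distr (K_measure n P) (lebesgue_n n) (theta_map n) = K_measure n (theta_mat n *\<^sub>v P)"
      using theta_mat_mult_vec[OF n2 P] by simp
  qed
qed

theorem proposition2p3:
  fixes n :: nat
  assumes "n \<ge> 3"
  shows "\<exists>G. rhin_viola_group (3 * n - 1) (K n) G
    \<and> card G = 32
    \<and> (GL (3 * n - 1))\<lparr>carrier := G\<rparr> \<cong>
        semidirect_product (klein_group \<times>\<times> klein_group) (integer_mod_group 2) swap_action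
    \<and> G = generate (GL (3 * n - 1)) {sigma_mat n, chi_mat n, theta_mat n}
    \<and> induced_by_change_of_variables n (sigma_mat n) (sigma_map n)
    \<and> hypergeometric_in_last_variable n (chi_mat n)
    \<and> induced_by_change_of_variables n (theta_mat n) (theta_map n)"
proof (intro exI conjI)
  have n: "2 \<le> n" using assms by simp
  interpret klein_wreath_generators "GL (3 * n - 1)" "sigma_mat n" "chi_mat n" "theta_mat n"
    by (rule klein_wreath_generators_GL[OF assms])
  let ?G = "generate (GL (3 * n - 1)) {sigma_mat n, chi_mat n, theta_mat n}"
  show sigma: "induced_by_change_of_variables n (sigma_mat n) (sigma_map n)"
    by (rule sigma_change_of_variables[OF n])
  show theta: "induced_by_change_of_variables n (theta_mat n) (theta_map n)"
    by (rule theta_change_of_variables[OF assms])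
  show "hypergeometric_in_last_variable n (chi_mat n)"
    by (rule hypergeometric_chi[OF n])
  show "card ?G = 32" "(GL (3 * n - 1))\<lparr>carrier := ?G\<rparr> \<cong> wreath"
    by (rule card_generate generate_iso_wreath, rule wreath_map_inj[OF assms])+
  show "rhin_viola_group (3 * n - 1) (K n) ?G"
  proof (rule rhin_viola_group_generate[OF assms K_pos])
    fix P :: "int vec" assume P: "P \<in> carrier_vec (3 * n - 1)"
    show "K n (sigma_fun n P) = K n P"
      using induced_imp_K_eq[OF sigma P] by (simp add: sigma_mat_mult_vec[OF n P])
    show "K n (theta_fun n P) = K n P"
      using induced_imp_K_eq[OF theta P] by (simp add: theta_mat_mult_vec[OF n P])
    show "0 \<le> parA n P n \<and> 0 \<le> parB n P n" if "K n P \<noteq> \<infinity>"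
      by (rule K_finite_imp_nonneg[OF n that])
    show "\<exists>q::rat. 0 < q \<and> K n (chi_fun n P) = ennreal (of_rat q) * K n P"
      if "K n P \<noteq> \<infinity>" "0 \<le> parC n P n" "parC n P n \<le> parA n P n + parB n P n"
      by (rule K_chi_ratio[OF n P that])
  qed
qed simp

end
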